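(* Let $\psi\colon \mathbb{R}^2\to\mathbb{R}$ be a $C^3$-differentiable function satisfying the zero mean curvature equation $$(1-\psi_y^2)\psi_{xx}+2\psi_x\psi_y\psi_{xy}+(1-\psi_x^2)\psi_{yy}=0$$ on all of $\mathbb{R}^2$. Suppose that the graph of $\psi$ is not a plane and that $\psi$ has at least one space-like point. Then $\psi$ has a non-degenerate light-like point; that is, there exists $p\in\mathbb{R}^2$ with $B_\psi(p)=0$ and $\nabla B_\psi(p)\neq (0,0)$, where $B_\psi:=1-\psi_x^2-\psi_y^2$.
   Context: Let $\mathbb{L}^3$ be Lorentz-Minkowski 3-space with coordinates $(x,y,t)$ and signature $(++-)$. An entire ZMC-graph (ZMC = zero mean curvature) is the graph $t=\psi(x,y)$ in $\mathbb{L}^3$ of a function $\psi\colon\mathbb{R}^2\to\mathbb{R}$ satisfying the zero mean curvature equation displayed in the claim at every point of $\mathbb{R}^2$. Subscripts denote partial derivatives. Put $B_\psi:=1-\psi_x^2-\psi_y^2$. A point $p\in\mathbb{R}^2$ is space-like if $B_\psi(p)>0$, time-like if $B_\psi(p)<0$, and light-like if $B_\psi(p)=0$. A light-like point $p$ is non-degenerate if the gradient $\nabla B_\psi$ does not vanish at $p$, and degenerate if it vanishes at $p$. The graph of $\psi$ is a plane if and only if $\psi-\psi(0,0)$ is a linear function. *)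

theory Defs
  imports "HOL-Analysis.Analysis"
begin

definition partial_x :: "(real \<times> real \<Rightarrow> real) \<Rightarrow> real \<times> real \<Rightarrow> real" where
  "partial_x f p = deriv (\<lambda>s. f (s, snd p)) (fst p)"

definition partial_y :: "(real \<times> real \<Rightarrow> real) \<Rightarrow> real \<times> real \<Rightarrow> real" where
  "partial_y f p = deriv (\<lambda>s. f (fst p, s)) (snd p)"

definition has_partials :: "(real \<times> real \<Rightarrow> real) \<Rightarrow> bool" where
  "has_partials f \<longleftrightarrow>
     (\<forall>x y. (\<lambda>s. f (s, y)) differentiable (at x) \<and> (\<lambda>s. f (x, s)) differentiable (at y))"

(* C^k on the whole plane: every partial derivative of order at most k exists everywhere
   and is continuous.  Existence is a separate conjunct because deriv is a total function. *)
primrec C_diff :: "nat \<Rightarrow> (real \<times> real \<Rightarrow> real) \<Rightarrow> bool" where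
  "C_diff 0 f \<longleftrightarrow> continuous_on UNIV f"
| "C_diff (Suc k) f \<longleftrightarrow>
     continuous_on UNIV f \<and> has_partials f \<and> C_diff k (partial_x f) \<and> C_diff k (partial_y f)"

definition grad :: "(real \<times> real \<Rightarrow> real) \<Rightarrow> real \<times> real \<Rightarrow> real \<times> real" where
  "grad f p = (partial_x f p, partial_y f p)"

definition zmc_equation :: "(real \<times> real \<Rightarrow> real) \<Rightarrow> real \<times> real \<Rightarrow> bool" where
  "zmc_equation \<psi> p \<longleftrightarrow>
     (1 - (partial_y \<psi> p)\<^sup>2) * partial_x (partial_x \<psi>) p
     + 2 * partial_x \<psi> p * partial_y \<psi> p * partial_y (partial_x \<psi>) p
     + (1 - (partial_x \<psi> p)\<^sup>2) * partial_y (partial_y \<psi>) p = 0"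

definition B :: "(real \<times> real \<Rightarrow> real) \<Rightarrow> real \<times> real \<Rightarrow> real" where
  "B \<psi> p = 1 - (partial_x \<psi> p)\<^sup>2 - (partial_y \<psi> p)\<^sup>2"

definition space_like :: "(real \<times> real \<Rightarrow> real) \<Rightarrow> real \<times> real \<Rightarrow> bool" where
  "space_like \<psi> p \<longleftrightarrow> B \<psi> p > 0"

definition light_like :: "(real \<times> real \<Rightarrow> real) \<Rightarrow> real \<times> real \<Rightarrow> bool" where
  "light_like \<psi> p \<longleftrightarrow> B \<psi> p = 0"

definition nondegenerate_light_like :: "(real \<times> real \<Rightarrow> real) \<Rightarrow> real \<times> real \<Rightarrow> bool" where
  "nondegenerate_light_like \<psi> p \<longleftrightarrow> light_like \<psi> p \<and> grad (B \<psi>) p \<noteq> (0, 0)"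

definition graph_of :: "(real \<times> real \<Rightarrow> real) \<Rightarrow> (real \<times> real \<times> real) set" where
  "graph_of \<psi> = {(x, y, t). t = \<psi> (x, y)}"

definition is_plane :: "(real \<times> real \<times> real) set \<Rightarrow> bool" where
  "is_plane S \<longleftrightarrow> affine S \<and> aff_dim S = 2"

lemma is_plane_graph_iff:
  "is_plane (graph_of \<psi>) \<longleftrightarrow> linear (\<lambda>p. \<psi> p - \<psi> (0, 0))"
proof
  assume "is_plane (graph_of \<psi>)"
  then have aff: "affine (graph_of \<psi>)" by (simp add: is_plane_def)
  have comb: "\<psi> (u *\<^sub>R p + v *\<^sub>R q) = u * \<psi> p + v * \<psi> q" if "u + v = 1" for u v p q
  proof -
    have "u *\<^sub>R (fst p, snd p, \<psi> p) + v *\<^sub>R (fst q, snd q, \<psi> q) \<in> graph_of \<psi>"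
      using aff that by (intro mem_affine) (auto simp: graph_of_def)
    then show ?thesis
      by (simp add: graph_of_def scaleR_prod_def)
  qed
  have scale: "\<psi> (c *\<^sub>R p) - \<psi> (0, 0) = c * (\<psi> p - \<psi> (0, 0))" for c p
    using comb[of c "1 - c" p "(0, 0)"] by (cases p) (simp add: algebra_simps)
  show "linear (\<lambda>p. \<psi> p - \<psi> (0, 0))"
  proof (rule linearI)
    fix p q :: "real \<times> real"
    have "\<psi> (p + q) - \<psi> (0, 0) = 2 * (\<psi> ((1/2) *\<^sub>R (p + q)) - \<psi> (0, 0))"
      using scale[of 2 "(1/2) *\<^sub>R (p + q)"] by simp
    also have "\<psi> ((1/2) *\<^sub>R (p + q)) = (\<psi> p + \<psi> q) / 2"
      using comb[of "1/2" "1/2" p q] by (simp add: scaleR_add_right add_divide_distrib)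
    finally show "\<psi> (p + q) - \<psi> (0, 0) = (\<psi> p - \<psi> (0, 0)) + (\<psi> q - \<psi> (0, 0))"
      by (simp add: field_simps)
  qed (simp add: scale)
next
  assume L: "linear (\<lambda>p. \<psi> p - \<psi> (0, 0))"
  define h where "h = (\<lambda>p. (fst p, snd p, \<psi> p - \<psi> (0, 0)))"
  have lin: "linear h"
    unfolding h_def
    by (intro linearI) (auto simp: linear_add[OF L] linear_scale[OF L])
  have inj: "inj h"
    by (auto simp: inj_def h_def)
  have eq: "graph_of \<psi> = (+) (0, 0, \<psi> (0, 0)) ` range h"
    by (force simp: graph_of_def h_def image_iff)
  have "affine (range h)"
    using lin by (simp add: subspace_imp_affine linear_subspace_image)
  moreover have "aff_dim (range h) = 2"
    using aff_dim_injective_linear_image[OF lin inj, of UNIV] by simp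
  ultimately show "is_plane (graph_of \<psi>)"
    unfolding is_plane_def eq by (simp add: affine_translation[symmetric] aff_dim_translation_eq)
qed

end

theory Submission
  imports Defs "HOL-Complex_Analysis.Complex_Analysis"
begin

text \<open>Suppose that every light-like point is degenerate, and write
  \<open>B = 1 - \<psi>\<^sub>x\<^sup>2 - \<psi>\<^sub>y\<^sup>2\<close>. The zero mean curvature equation says
  \<open>\<langle>\<nabla>B, \<nabla>\<psi>\<rangle> = 2 B \<Delta>\<psi>\<close>, and since \<open>B\<close> has only degenerate zeros, \<open>|\<nabla>B|\<^sup>2 \<le> C |B|\<close> on compact sets.
  By Gronwall the whole line through a light-like point \<open>z\<close> in direction \<open>\<nabla>\<psi>(z)\<close> is light-like with constant
  \<open>\<nabla>\<psi>\<close>. Such lines cannot cross, so they are parallel and a space-like point lies in an open convex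
  strip \<open>\<Omega>\<close> (possibly the whole plane) on which \<open>B > 0\<close> and on whose frontier \<open>B = 0\<close>.

  On \<open>\<Omega>\<close> the conformal metric \<open>(1 + \<surd>B)\<^sup>2 (dx\<^sup>2 + dy\<^sup>2 - d\<psi>\<^sup>2) / B\<close> is flat: it is the pull-back of the
  Euclidean metric under an expanding map \<open>T\<close>, found as in Nitsche's proof of Bernstein's theorem
  for the dual minimal graph. The two estimates above bound \<open>log B\<close> in this metric locally near the frontier, which
  makes the metric complete, so \<open>T\<close> maps \<open>\<Omega>\<close> onto the plane. In the coordinate \<open>T\<close> the Gauss map
  \<open>(\<psi>\<^sub>x - i \<psi>\<^sub>y) / (1 + \<surd>B)\<close> is entire and bounded, hence constant by Liouville. Thus \<open>B\<close> is a positive constant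
  on \<open>\<Omega>\<close>, the frontier is empty, and \<open>\<psi>\<close> is affine.\<close>

section \<open>Real-valued functions of class C1 on the complex plane\<close>

text \<open>The continuous partial derivatives enter as existential witnesses, so closure under sums
  and products follows by exhibiting new ones. The domain is \<open>complex\<close> because
  Liouville's theorem is applied there in the end.\<close>

definition C1 :: "(complex \<Rightarrow> real) \<Rightarrow> bool" where
  "C1 f \<longleftrightarrow> (\<exists>a c. continuous_on UNIV a \<and> continuous_on UNIV c \<and>
     (\<forall>z. (f has_derivative (\<lambda>h. a z * Re h + c z * Im h)) (at z)))"

lemma C1_I:
  assumes "\<And>z. (f has_derivative (\<lambda>h. a z * Re h + c z * Im h)) (at z)"
    and "continuous_on UNIV a" "continuous_on UNIV c"
  shows "C1 f"
  using assms unfolding C1_def by blast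

lemma C1_const: "C1 (\<lambda>_. k)"
  by (rule C1_I[where a = "\<lambda>_. 0" and c = "\<lambda>_. 0"]) (auto intro!: derivative_eq_intros)

lemma C1_continuous: "C1 f \<Longrightarrow> continuous_on UNIV f"
  unfolding C1_def continuous_on_eq_continuous_within
  using has_derivative_continuous by blast

lemma C1_add:
  assumes "C1 f" "C1 g"
  shows "C1 (\<lambda>z. f z + g z)"
proof -
  obtain a c a' c' where *: "continuous_on UNIV a" "continuous_on UNIV c"
    "continuous_on UNIV a'" "continuous_on UNIV c'"
    "\<And>z. (f has_derivative (\<lambda>h. a z * Re h + c z * Im h)) (at z)"
    "\<And>z. (g has_derivative (\<lambda>h. a' z * Re h + c' z * Im h)) (at z)"
    using assms unfolding C1_def by blast
  show ?thesis
  proof (rule C1_I)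
    show "((\<lambda>z. f z + g z) has_derivative (\<lambda>h. (a z + a' z) * Re h + (c z + c' z) * Im h)) (at z)" for z
      by (rule has_derivative_eq_rhs[OF has_derivative_add[OF *(5,6)]]) (simp add: algebra_simps)
  qed (intro continuous_intros *)+
qed

lemma C1_mult:
  assumes "C1 f" "C1 g"
  shows "C1 (\<lambda>z. f z * g z)"
proof -
  obtain a c a' c' where *: "continuous_on UNIV a" "continuous_on UNIV c"
    "continuous_on UNIV a'" "continuous_on UNIV c'"
    "\<And>z. (f has_derivative (\<lambda>h. a z * Re h + c z * Im h)) (at z)"
    "\<And>z. (g has_derivative (\<lambda>h. a' z * Re h + c' z * Im h)) (at z)"
    using assms unfolding C1_def by blast
  show ?thesis
  proof (rule C1_I)
    show "((\<lambda>z. f z * g z) has_derivative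
        (\<lambda>h. (f z * a' z + a z * g z) * Re h + (f z * c' z + c z * g z) * Im h)) (at z)" for z
      by (rule has_derivative_eq_rhs[OF has_derivative_mult[OF *(5,6)]]) (simp add: algebra_simps)
  qed (intro continuous_intros * C1_continuous assms)+
qed

lemma C1_minus: "C1 f \<Longrightarrow> C1 (\<lambda>z. - f z)"
  using C1_mult[OF C1_const[of "-1"]] by simp

section \<open>Estimates on closed discs\<close>

lemma bounded_on_cball:
  assumes "continuous_on UNIV (f :: complex \<Rightarrow> real)"
  obtains M where "M \<ge> 0" "\<And>z. z \<in> cball 0 R \<Longrightarrow> \<bar>f z\<bar> \<le> M"
proof -
  have "bounded (f ` cball 0 R)"
    by (intro compact_imp_bounded compact_continuous_image) (auto intro: continuous_on_subset[OF assms])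
  then obtain M where "M > 0" "\<forall>x\<in>f ` cball 0 R. norm x \<le> M"
    unfolding bounded_pos by blast
  then show ?thesis
    by (intro that[of M]) auto
qed

text \<open>The mean value inequality on a convex disc; the operator norm of the derivative is at
  most the sum of the bounds for the two partial derivatives.\<close>

lemma C1_lipschitz_on_cball:
  assumes "C1 f"
  obtains M where "M \<ge> 0"
    "\<And>y z. y \<in> cball 0 R \<Longrightarrow> z \<in> cball 0 R \<Longrightarrow> \<bar>f y - f z\<bar> \<le> M * cmod (y - z)"
proof -
  obtain a c where ac: "continuous_on UNIV a" "continuous_on UNIV c"
    and der: "\<And>z. (f has_derivative (\<lambda>h. a z * Re h + c z * Im h)) (at z)"
    using assms unfolding C1_def by blast
  obtain K where K: "K \<ge> 0" "\<And>z. z \<in> cball 0 R \<Longrightarrow> \<bar>a z\<bar> \<le> K"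
    using bounded_on_cball[OF ac(1), where R = R] by blast
  obtain L where L: "L \<ge> 0" "\<And>z. z \<in> cball 0 R \<Longrightarrow> \<bar>c z\<bar> \<le> L"
    using bounded_on_cball[OF ac(2), where R = R] by blast
  show ?thesis
  proof (rule that[of "K + L"])
    show "\<bar>f y - f z\<bar> \<le> (K + L) * cmod (y - z)" if "y \<in> cball 0 R" "z \<in> cball 0 R" for y z
      using that
    proof (rule differentiable_bound[of "cball 0 R" f "\<lambda>z h. a z * Re h + c z * Im h",
          unfolded real_norm_def, rotated 3])
      show "onorm (\<lambda>h. a x * Re h + c x * Im h) \<le> K + L" if "x \<in> cball 0 R" for x
      proof (rule onorm_le)
        fix h
        have "\<bar>a x * Re h\<bar> \<le> K * cmod h" "\<bar>c x * Im h\<bar> \<le> L * cmod h"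
          unfolding abs_mult using K L that abs_Re_le_cmod abs_Im_le_cmod by (auto intro!: mult_mono)
        then show "norm (a x * Re h + c x * Im h) \<le> (K + L) * norm h"
          by (simp add: algebra_simps)
      qed
    qed (auto intro: has_derivative_at_withinI der)
  qed (use K L in auto)
qed

text \<open>The value at the end of a gradient descent step of length
  proportional to the gradient is still positive unless the step meets a zero, at which the
  gradient vanishes by assumption.\<close>

lemma gradient_bound_positive:
  assumes der: "\<And>z. (f has_derivative (\<lambda>h. fx z * Re h + fy z * Im h)) (at z)"
    and C1: "C1 fx" "C1 fy"
    and zero: "\<And>z. f z = 0 \<Longrightarrow> fx z = 0 \<and> fy z = 0"
  obtains C where "C \<ge> 0" "\<And>z. z \<in> cball 0 R \<Longrightarrow> f z > 0 \<Longrightarrow> (fx z)\<^sup>2 + (fy z)\<^sup>2 \<le> C * f z"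
proof -
  define G where "G = (\<lambda>z. Complex (fx z) (fy z))"
  have G: "Re (G z) = fx z" "Im (G z) = fy z" for z by (auto simp: G_def)
  have cG: "continuous_on UNIV (\<lambda>z. cmod (G z))"
    unfolding cmod_def G using C1_continuous[OF C1(1)] C1_continuous[OF C1(2)]
    by (intro continuous_intros)
  obtain N where N: "N \<ge> 0" "\<And>z. z \<in> cball 0 R \<Longrightarrow> cmod (G z) \<le> N"
    using bounded_on_cball[OF cG, where R = R] unfolding abs_norm_cancel by blast
  obtain M1 where M1: "M1 \<ge> 0"
    "\<And>y z. y \<in> cball 0 (R+1) \<Longrightarrow> z \<in> cball 0 (R+1) \<Longrightarrow> \<bar>fx y - fx z\<bar> \<le> M1 * cmod (y - z)"
    using C1_lipschitz_on_cball[OF C1(1), where R = "R + 1"] by blast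
  obtain M2 where M2: "M2 \<ge> 0"
    "\<And>y z. y \<in> cball 0 (R+1) \<Longrightarrow> z \<in> cball 0 (R+1) \<Longrightarrow> \<bar>fy y - fy z\<bar> \<le> M2 * cmod (y - z)"
    using C1_lipschitz_on_cball[OF C1(2), where R = "R + 1"] by blast
  \<comment> \<open>\<open>N \<le> K\<close> keeps the step \<open>v = G z / K\<close> of length at
    most 1, inside the disc of radius \<open>R + 1\<close>; \<open>M1 + M2 \<le> K / 2\<close> lets
    the gradient change by at most half of \<open>cmod (G z)\<close> along it. The summand 1 makes
    \<open>K\<close> positive.\<close>
  define K where "K = 2 * (M1 + M2) + N + 1"
  have K: "K > 0" "M1 + M2 \<le> K / 2" "N \<le> K" using M1(1) M2(1) N(1) by (auto simp: K_def)
  have lip: "cmod (G y - G z) \<le> K / 2 * cmod (y - z)"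
    if "y \<in> cball 0 (R+1)" "z \<in> cball 0 (R+1)" for y z
  proof -
    have "cmod (G y - G z) \<le> \<bar>fx y - fx z\<bar> + \<bar>fy y - fy z\<bar>"
      using cmod_le[of "G y - G z"] by (simp add: G)
    also have "\<dots> \<le> (M1 + M2) * cmod (y - z)"
      using M1(2)[OF that] M2(2)[OF that] by (simp add: algebra_simps)
    also have "\<dots> \<le> K / 2 * cmod (y - z)"
      using K by (intro mult_right_mono) auto
    finally show ?thesis .
  qed
  show ?thesis
  proof (rule that[of "2 * K"])
    fix z assume z: "z \<in> cball 0 R" and pos: "f z > 0"
    define v where "v = G z / of_real K"
    have v: "cmod v = cmod (G z) / K" using K by (simp add: v_def norm_divide)
    have v1: "cmod v \<le> 1" unfolding v using N(2)[OF z] K by (simp add: divide_le_eq)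
    define h where "h = (\<lambda>\<tau>. f (z - of_real \<tau> * v))"
    have near: "z - of_real \<tau> * v \<in> cball 0 (R+1)" "z \<in> cball 0 (R+1)"
      and dG: "cmod (G z - G (z - of_real \<tau> * v)) \<le> cmod (G z) / 2"
      if "\<tau> \<in> {0..1}" for \<tau>
    proof -
      have *: "cmod (of_real \<tau> * v) \<le> cmod v" using that by (simp add: norm_mult mult_left_le_one_le)
      have "cmod (z - of_real \<tau> * v) \<le> cmod z + cmod (of_real \<tau> * v)" by (rule norm_triangle_ineq4)
      then show 1: "z - of_real \<tau> * v \<in> cball 0 (R+1)" using * v1 z by simp
      show 2: "z \<in> cball 0 (R+1)" using z by simp
      have "cmod (G z - G (z - of_real \<tau> * v)) \<le> K / 2 * cmod (of_real \<tau> * v)"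
        using lip[OF 2 1] by simp
      also have "\<dots> \<le> K / 2 * cmod v" using K * by (intro mult_left_mono) auto
      finally show "cmod (G z - G (z - of_real \<tau> * v)) \<le> cmod (G z) / 2" using K by (simp add: v)
    qed
    have dh: "(h has_derivative (\<lambda>k. - (fx (z - of_real \<tau> * v) * Re v + fy (z - of_real \<tau> * v) * Im v) * k)) (at \<tau>)" for \<tau>
    proof -
      have "((\<lambda>\<tau>. z - of_real \<tau> * v) has_derivative (\<lambda>k. - of_real k * v)) (at \<tau>)"
        by (auto intro!: derivative_eq_intros)
      from has_derivative_compose[OF this der] show ?thesis
        unfolding h_def by (rule has_derivative_eq_rhs) (auto simp: algebra_simps)
    qed
    have normG: "(fx z)\<^sup>2 + (fy z)\<^sup>2 = (cmod (G z))\<^sup>2" by (simp add: cmod_power2 G)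
    show "(fx z)\<^sup>2 + (fy z)\<^sup>2 \<le> 2 * K * f z"
    proof (cases "h 1 > 0")
      \<comment> \<open>Along the step \<open>f\<close> falls at no less than half the initial rate,
        hence by at least \<open>(cmod (G z))^2 / (2 * K)\<close> in total; as it is still positive
        at the end, \<open>f z\<close> is at least this amount.\<close>
      case True
      obtain \<tau> where \<tau>: "\<tau> \<in> {0<..<1}" and mv: "h 1 - h 0 = - (fx (z - of_real \<tau> * v) * Re v + fy (z - of_real \<tau> * v) * Im v)"
        using mvt_simple[of 0 1 h, OF _ has_derivative_at_withinI[OF dh]] by auto
      define y where "y = z - of_real \<tau> * v"
      have "fx y * Re v + fy y * Im v = G y \<bullet> v" by (simp add: inner_complex_def G)
      also have "\<dots> = G z \<bullet> v - (G z - G y) \<bullet> v" by (simp add: inner_diff_left)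
      also have "\<dots> \<ge> G z \<bullet> v - cmod (G z) / 2 * cmod v"
      proof -
        have "(G z - G y) \<bullet> v \<le> cmod (G z - G y) * cmod v" by (rule norm_cauchy_schwarz)
        also have "\<dots> \<le> cmod (G z) / 2 * cmod v"
          using dG[of \<tau>] \<tau> by (intro mult_right_mono) (auto simp: y_def)
        finally show ?thesis by simp
      qed
      finally have "G z \<bullet> v - cmod (G z) / 2 * cmod v \<le> f z"
        using mv True by (simp add: y_def h_def)
      moreover have "G z \<bullet> v = (cmod (G z))\<^sup>2 / K"
        by (simp add: v_def dot_square_norm[symmetric] inner_complex_def add_divide_distrib)
      ultimately show ?thesis using K unfolding normG v by (simp add: field_simps power2_eq_square)
    next
      case False
      \<comment> \<open>A zero of \<open>f\<close> on the step is a zero of the gradient by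
        assumption; the gradient there differs from \<open>G z\<close> by at most half of
        \<open>cmod (G z)\<close>, so \<open>G z = 0\<close>.\<close>
      have "continuous_on {0..1} h"
        using dh has_derivative_continuous by (blast intro: continuous_at_imp_continuous_on)
      then obtain \<tau> where \<tau>: "0 \<le> \<tau>" "\<tau> \<le> 1" "h \<tau> = 0"
        using IVT2'[of h 1 0 0] False pos by (auto simp: h_def)
      then have "G (z - of_real \<tau> * v) = 0"
        using zero[of "z - of_real \<tau> * v"] by (simp add: h_def G_def complex_eq_iff)
      with dG[of \<tau>] \<tau> have "G z = 0" by auto
      then show ?thesis using normG pos K by simp
    qed
  qed (use K in auto)
qed

text \<open>The positive case is applied to \<open>f\<close> and to \<open>- f\<close>; at a zero of
  \<open>f\<close> both sides vanish.\<close>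

lemma gradient_bound:
  assumes der: "\<And>z. (f has_derivative (\<lambda>h. fx z * Re h + fy z * Im h)) (at z)"
    and C1: "C1 fx" "C1 fy"
    and zero: "\<And>z. f z = 0 \<Longrightarrow> fx z = 0 \<and> fy z = 0"
  obtains C where "C \<ge> 0" "\<And>z. z \<in> cball 0 R \<Longrightarrow> (fx z)\<^sup>2 + (fy z)\<^sup>2 \<le> C * \<bar>f z\<bar>"
proof -
  obtain C where C: "C \<ge> 0" "\<And>z. z \<in> cball 0 R \<Longrightarrow> f z > 0 \<Longrightarrow> (fx z)\<^sup>2 + (fy z)\<^sup>2 \<le> C * f z"
    using gradient_bound_positive[of f, OF assms] by blast
  have "((\<lambda>z. - f z) has_derivative (\<lambda>h. - fx z * Re h + - fy z * Im h)) (at z)" for z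
    by (rule derivative_eq_intros der refl)+ (auto simp: algebra_simps)
  then obtain D where D: "D \<ge> 0"
    "\<And>z. z \<in> cball 0 R \<Longrightarrow> - f z > 0 \<Longrightarrow> (- fx z)\<^sup>2 + (- fy z)\<^sup>2 \<le> D * - f z"
    by (rule gradient_bound_positive[of "\<lambda>z. - f z" _ _ R])
      (use C1 zero in \<open>auto intro: C1_minus\<close>)
  show ?thesis
  proof (rule that[of "C + D"])
    fix z :: complex assume z: "z \<in> cball 0 R"
    consider "f z > 0" | "f z < 0" | "f z = 0" by linarith
    then show "(fx z)\<^sup>2 + (fy z)\<^sup>2 \<le> (C + D) * \<bar>f z\<bar>"
    proof cases
      case 1 
      have "0 \<le> D * f z" using D 1 by simp
      then show ?thesis using C(2)[OF z 1] 1 by (simp add: algebra_simps)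
    next
      case 2
      have "0 \<le> C * - f z" using C 2 by (intro mult_nonneg_nonneg) auto
      then show ?thesis using D(2)[OF z] 2 by (simp add: algebra_simps)
    qed (simp add: zero)
  qed (use C D in auto)
qed

section \<open>Degenerate light-like points\<close>

text \<open>Gronwall's argument on both sides of 0: \<open>f x * exp (- K * x)\<close> is
  nonincreasing on the right, \<open>f x * exp (K * x)\<close> is nondecreasing on the left, and
  both vanish at 0.\<close>

lemma gronwall_zero:
  fixes f f' :: "real \<Rightarrow> real"
  assumes der: "\<And>x. \<bar>x\<bar> \<le> R \<Longrightarrow> (f has_real_derivative f' x) (at x)"
    and bound: "\<And>x. \<bar>x\<bar> \<le> R \<Longrightarrow> \<bar>f' x\<bar> \<le> K * f x"
    and "f 0 = 0" "\<bar>x\<bar> \<le> R"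
  shows "f x \<le> 0"
proof (cases "x \<ge> 0")
  case True
  have "f x * exp (- K * x) \<le> f 0 * exp (- K * 0)"
  proof (rule DERIV_nonpos_imp_nonincreasing[OF True])
    fix y assume y: "0 \<le> y" "y \<le> x"
    then have "\<bar>y\<bar> \<le> R" using assms(4) by auto
    note d = der[OF this] and b = bound[OF this]
    have "((\<lambda>y. f y * exp (- K * y)) has_real_derivative (f' y - K * f y) * exp (- K * y)) (at y)"
      by (rule derivative_eq_intros d refl)+ (simp add: algebra_simps)
    moreover have "(f' y - K * f y) * exp (- K * y) \<le> 0"
      using b by (intro mult_nonpos_nonneg) auto
    ultimately show "\<exists>d. ((\<lambda>y. f y * exp (- K * y)) has_real_derivative d) (at y) \<and> d \<le> 0" by blast
  qed
  then show ?thesis using \<open>f 0 = 0\<close> by (simp add: mult_le_0_iff)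
next
  case False
  then have "x \<le> 0" by simp
  have "f x * exp (K * x) \<le> f 0 * exp (K * 0)"
  proof (rule DERIV_nonneg_imp_nondecreasing[OF \<open>x \<le> 0\<close>])
    fix y assume y: "x \<le> y" "y \<le> 0"
    then have "\<bar>y\<bar> \<le> R" using assms(4) by auto
    note d = der[OF this] and b = bound[OF this]
    have "((\<lambda>y. f y * exp (K * y)) has_real_derivative (f' y + K * f y) * exp (K * y)) (at y)"
      by (rule derivative_eq_intros d refl)+ (simp add: algebra_simps)
    moreover have "(f' y + K * f y) * exp (K * y) \<ge> 0"
      using b by (intro mult_nonneg_nonneg) auto
    ultimately show "\<exists>d. ((\<lambda>y. f y * exp (K * y)) has_real_derivative d) (at y) \<and> d \<ge> 0" by blast
  qed
  then show ?thesis using \<open>f 0 = 0\<close> by (simp add: mult_le_0_iff)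
qed

lemma has_real_derivative_along_line:
  assumes "\<And>z. (f has_derivative (\<lambda>h. a z * Re h + c z * Im h)) (at z)"
  shows "((\<lambda>x. f (z + of_real x * e)) has_real_derivative
    a (z + of_real x * e) * Re e + c (z + of_real x * e) * Im e) (at x)"
proof -
  have "((\<lambda>x. z + of_real x * e) has_derivative (\<lambda>k. of_real k * e)) (at x)"
    by (auto intro!: derivative_eq_intros)
  from has_derivative_compose[OF this assms] show ?thesis
    unfolding has_field_derivative_def
    by (rule has_derivative_eq_rhs) (auto simp: algebra_simps)
qed

text \<open>The plane is identified with the complex numbers; \<open>p, q\<close> stand for \<open>\<psi>\<^sub>x, \<psi>\<^sub>y\<close> and
  \<open>r, s, t\<close> for \<open>\<psi>\<^sub>x\<^sub>x, \<psi>\<^sub>x\<^sub>y, \<psi>\<^sub>y\<^sub>y\<close>. The last assumption denies the existence of non-degenerate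
  light-like points.\<close>

locale zmc_gradient =
  fixes p q r s t :: "complex \<Rightarrow> real"
  assumes p_der: "\<And>z. (p has_derivative (\<lambda>h. r z * Re h + s z * Im h)) (at z)"
    and q_der: "\<And>z. (q has_derivative (\<lambda>h. s z * Re h + t z * Im h)) (at z)"
    and C1_r: "C1 r" and C1_s: "C1 s" and C1_t: "C1 t"
    and zmc: "\<And>z. (1 - (q z)\<^sup>2) * r z + 2 * p z * q z * s z + (1 - (p z)\<^sup>2) * t z = 0"
    and degenerate: "\<And>z. (p z)\<^sup>2 + (q z)\<^sup>2 = 1 \<Longrightarrow>
      p z * r z + q z * s z = 0 \<and> p z * s z + q z * t z = 0"
begin

definition "\<beta> = (\<lambda>z. 1 - (p z)\<^sup>2 - (q z)\<^sup>2)"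
definition "\<beta>x = (\<lambda>z. - 2 * (p z * r z + q z * s z))"
definition "\<beta>y = (\<lambda>z. - 2 * (p z * s z + q z * t z))"

lemma C1_p: "C1 p" and C1_q: "C1 q"
  by (rule C1_I[OF p_der] C1_I[OF q_der]; intro C1_continuous C1_r C1_s C1_t)+

lemma C1_\<beta>x: "C1 \<beta>x" and C1_\<beta>y: "C1 \<beta>y"
  unfolding \<beta>x_def \<beta>y_def by (intro C1_mult C1_add C1_const C1_p C1_q C1_r C1_s C1_t)+

lemma \<beta>_der: "(\<beta> has_derivative (\<lambda>h. \<beta>x z * Re h + \<beta>y z * Im h)) (at z)"
proof -
  have "((\<lambda>z. 1 - p z * p z - q z * q z) has_derivative (\<lambda>h. \<beta>x z * Re h + \<beta>y z * Im h)) (at z)"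
    by (rule derivative_eq_intros p_der q_der refl)+
      (auto simp: \<beta>x_def \<beta>y_def algebra_simps)
  then show ?thesis by (simp add: \<beta>_def power2_eq_square)
qed

lemma continuous_p: "continuous_on A p" and continuous_q: "continuous_on A q"
  and continuous_r: "continuous_on A r" and continuous_s: "continuous_on A s"
  and continuous_t: "continuous_on A t" and continuous_\<beta>: "continuous_on A \<beta>"
  unfolding \<beta>_def
  by (intro continuous_intros continuous_on_subset[OF C1_continuous] C1_p C1_q C1_r C1_s C1_t subset_UNIV)+

lemma \<beta>_zero: "\<beta> z = 0 \<Longrightarrow> \<beta>x z = 0 \<and> \<beta>y z = 0"
  using degenerate[of z] by (auto simp: \<beta>_def \<beta>x_def \<beta>y_def)

text \<open>The zero mean curvature equation rearranges to
  \<open>\<beta> * (r + t) = - (p^2 * r + 2 * p * q * s + q^2 * t)\<close>, and the bracket is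
  \<open>-1/2\<close> times the left-hand side here.\<close>

lemma \<beta>_transport: "\<beta>x z * p z + \<beta>y z * q z = 2 * \<beta> z * (r z + t z)"
  using zmc[of z] unfolding \<beta>_def \<beta>x_def \<beta>y_def by algebra

text \<open>Along the line, \<open>E = B\<^sup>2 + |\<nabla>\<psi> - e|\<^sup>4\<close> satisfies \<open>|E'| \<le> K E\<close>: both \<open>\<langle>\<nabla>B, \<nabla>\<psi>\<rangle>\<close> and
  \<open>D\<^sup>2\<psi> \<nabla>\<psi> = - \<nabla>B / 2\<close> are controlled by \<open>B\<close>.\<close>

lemma light_like_line:
  assumes "\<beta> z = 0"
  defines "e \<equiv> Complex (p z) (q z)"
  shows "p (z + of_real x * e) = p z" "q (z + of_real x * e) = q z"
proof -
  define \<gamma> where "\<gamma> = (\<lambda>x. z + of_real x * e)"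
  define \<rho> where "\<rho> = cmod z + \<bar>x\<bar>"
  have e1: "cmod e = 1" using assms(1) by (simp add: e_def \<beta>_def complex_norm)
  have \<gamma>: "\<gamma> y \<in> cball 0 \<rho>" if "\<bar>y\<bar> \<le> \<bar>x\<bar>" for y
    using that norm_triangle_ineq[of z "of_real y * e"] by (simp add: \<gamma>_def \<rho>_def norm_mult e1)
  obtain C where C: "C \<ge> 0" "\<And>z. z \<in> cball 0 \<rho> \<Longrightarrow> (\<beta>x z)\<^sup>2 + (\<beta>y z)\<^sup>2 \<le> C * \<bar>\<beta> z\<bar>"
    using gradient_bound[OF \<beta>_der C1_\<beta>x C1_\<beta>y \<beta>_zero, where R = \<rho>] by blast
  obtain N1 where N1: "N1 \<ge> 0" "\<And>z. z \<in> cball 0 \<rho> \<Longrightarrow> \<bar>r z\<bar> \<le> N1"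
    using bounded_on_cball[OF continuous_r, where R = \<rho>] by blast
  obtain N2 where N2: "N2 \<ge> 0" "\<And>z. z \<in> cball 0 \<rho> \<Longrightarrow> \<bar>s z\<bar> \<le> N2"
    using bounded_on_cball[OF continuous_s, where R = \<rho>] by blast
  obtain N3 where N3: "N3 \<ge> 0" "\<And>z. z \<in> cball 0 \<rho> \<Longrightarrow> \<bar>t z\<bar> \<le> N3"
    using bounded_on_cball[OF continuous_t, where R = \<rho>] by blast
  define N where "N = N1 + N2 + N3"
  define u where "u = (\<lambda>y. p (\<gamma> y) - p z)"
  define v where "v = (\<lambda>y. q (\<gamma> y) - q z)"
  define b where "b = (\<lambda>y. \<beta> (\<gamma> y))"
  \<comment> \<open>\<open>X\<close> is the inner product of the gradient of \<open>\<beta>\<close>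
    with \<open>(u, v)\<close>, and \<open>Q\<close> is the Hessian form of \<psi> at
    \<open>(u, v)\<close>. \<open>E'\<close> is the derivative of \<open>E\<close> after the
    substitution \<open>e = (p, q) - (u, v)\<close> at \<open>\<gamma> y\<close>, which lets
    \<open>\<beta>_transport\<close> be used.\<close>
  define X where "X = (\<lambda>y. \<beta>x (\<gamma> y) * u y + \<beta>y (\<gamma> y) * v y)"
  define Q where "Q = (\<lambda>y. r (\<gamma> y) * (u y)\<^sup>2 + 2 * s (\<gamma> y) * u y * v y + t (\<gamma> y) * (v y)\<^sup>2)"
  define E where "E = (\<lambda>y. (b y)\<^sup>2 + ((u y)\<^sup>2 + (v y)\<^sup>2)\<^sup>2)"
  define E' where "E' = (\<lambda>y. 2 * b y * (2 * b y * (r (\<gamma> y) + t (\<gamma> y)) - X y)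
    + 4 * ((u y)\<^sup>2 + (v y)\<^sup>2) * (- X y / 2 - Q y))"
  have e: "Re e = p z" "Im e = q z" by (auto simp: e_def)
  have "E x \<le> 0"
  proof (rule gronwall_zero[of "\<bar>x\<bar>" E E' "8 * N + 4 * sqrt C"])
    fix y :: real assume y: "\<bar>y\<bar> \<le> \<bar>x\<bar>"
    have db: "(b has_real_derivative \<beta>x (\<gamma> y) * p z + \<beta>y (\<gamma> y) * q z) (at y)"
      unfolding b_def \<gamma>_def using has_real_derivative_along_line[OF \<beta>_der, of z e y] by (simp add: e)
    have du: "(u has_real_derivative r (\<gamma> y) * p z + s (\<gamma> y) * q z) (at y)"
      unfolding u_def \<gamma>_def using has_real_derivative_along_line[OF p_der, of z e y]
      by (auto intro!: derivative_eq_intros simp: e)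
    have dv: "(v has_real_derivative s (\<gamma> y) * p z + t (\<gamma> y) * q z) (at y)"
      unfolding v_def \<gamma>_def using has_real_derivative_along_line[OF q_der, of z e y]
      by (auto intro!: derivative_eq_intros simp: e)
    define D where "D = 2 * b y * (\<beta>x (\<gamma> y) * p z + \<beta>y (\<gamma> y) * q z)
      + 2 * ((u y)\<^sup>2 + (v y)\<^sup>2) * (2 * u y * (r (\<gamma> y) * p z + s (\<gamma> y) * q z)
        + 2 * v y * (s (\<gamma> y) * p z + t (\<gamma> y) * q z))"
    have "(E has_real_derivative D) (at y)"
      unfolding E_def by (rule derivative_eq_intros db du dv refl)+ (simp add: D_def algebra_simps)
    moreover have "D = E' y"
    proof -
      have pq: "p z = p (\<gamma> y) - u y" "q z = q (\<gamma> y) - v y" by (auto simp: u_def v_def)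
      have 1: "\<beta>x (\<gamma> y) * p z + \<beta>y (\<gamma> y) * q z = 2 * b y * (r (\<gamma> y) + t (\<gamma> y)) - X y"
        unfolding pq X_def b_def using \<beta>_transport[of "\<gamma> y"] by (simp add: algebra_simps)
      have 2: "u y * (r (\<gamma> y) * p z + s (\<gamma> y) * q z) + v y * (s (\<gamma> y) * p z + t (\<gamma> y) * q z) = - X y / 2 - Q y"
        unfolding pq X_def Q_def \<beta>x_def \<beta>y_def by (simp add: field_simps power2_eq_square)
      have "D = 2 * b y * (\<beta>x (\<gamma> y) * p z + \<beta>y (\<gamma> y) * q z) + 4 * ((u y)\<^sup>2 + (v y)\<^sup>2) *
        (u y * (r (\<gamma> y) * p z + s (\<gamma> y) * q z) + v y * (s (\<gamma> y) * p z + t (\<gamma> y) * q z))"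
        unfolding D_def by (simp add: algebra_simps)
      then show ?thesis unfolding 1 2 E'_def .
    qed
    ultimately show "(E has_real_derivative E' y) (at y)" by simp
    \<comment> \<open>In these variables \<open>E = a^4 + w^4\<close>, and since the gradient of
      \<open>\<beta>\<close> is of order \<open>a\<close>, every term of \<open>E'\<close> is
      bounded by a monomial of degree four.\<close>
    define a where "a = sqrt \<bar>b y\<bar>"
    define w where "w = sqrt ((u y)\<^sup>2 + (v y)\<^sup>2)"
    have aw: "a \<ge> 0" "w \<ge> 0" "a\<^sup>2 = \<bar>b y\<bar>" "w\<^sup>2 = (u y)\<^sup>2 + (v y)\<^sup>2"
      by (auto simp: a_def w_def)
    have a4: "(b y)\<^sup>2 = a^4"
    proof -
      have "a^4 = (a\<^sup>2)\<^sup>2" by simp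
      then show ?thesis unfolding aw(3) by simp
    qed
    have E: "E y = a^4 + w^4"
      unfolding E_def aw(4)[symmetric] a4 by simp
    have X: "\<bar>X y\<bar> \<le> sqrt C * a * w"
    proof (rule power2_le_imp_le)
      have "(X y)\<^sup>2 \<le> ((\<beta>x (\<gamma> y))\<^sup>2 + (\<beta>y (\<gamma> y))\<^sup>2) * w\<^sup>2"
      proof -
        have "((\<beta>x (\<gamma> y))\<^sup>2 + (\<beta>y (\<gamma> y))\<^sup>2) * w\<^sup>2 - (X y)\<^sup>2 = (\<beta>x (\<gamma> y) * v y - \<beta>y (\<gamma> y) * u y)\<^sup>2"
          unfolding aw X_def by algebra
        then show ?thesis by (metis diff_ge_0_iff_ge zero_le_power2)
      qed
      also have "\<dots> \<le> C * \<bar>b y\<bar> * w\<^sup>2"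
        unfolding b_def using C(2)[OF \<gamma>[OF y]] by (intro mult_right_mono) auto
      finally show "\<bar>X y\<bar>\<^sup>2 \<le> (sqrt C * a * w)\<^sup>2"
        using C(1) by (simp add: power_mult_distrib aw)
    qed (use aw C in auto)
    have bd: "\<bar>r (\<gamma> y)\<bar> \<le> N1" "\<bar>s (\<gamma> y)\<bar> \<le> N2" "\<bar>t (\<gamma> y)\<bar> \<le> N3"
      using N1 N2 N3 \<gamma>[OF y] by auto
    have Q: "\<bar>Q y\<bar> \<le> 2 * N * w\<^sup>2"
    proof -
      have "\<bar>r (\<gamma> y) * (u y)\<^sup>2\<bar> \<le> N1 * w\<^sup>2"
        unfolding abs_mult aw using bd N1 by (intro mult_mono) auto
      moreover have "\<bar>t (\<gamma> y) * (v y)\<^sup>2\<bar> \<le> N3 * w\<^sup>2"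
        unfolding abs_mult aw using bd N3 by (intro mult_mono) auto
      moreover have "\<bar>s (\<gamma> y) * (2 * u y * v y)\<bar> \<le> N2 * w\<^sup>2"
      proof -
        have "\<bar>2 * u y * v y\<bar> \<le> w\<^sup>2"
          unfolding aw using sum_squares_bound[of "\<bar>u y\<bar>" "\<bar>v y\<bar>"] by (simp add: abs_mult)
        then show ?thesis unfolding abs_mult[of "s _"] using bd N2 by (intro mult_mono) auto
      qed
      moreover have "N * w\<^sup>2 \<ge> 0" using N1 N2 N3 by (simp add: N_def)
      ultimately show ?thesis unfolding Q_def N_def by (simp add: algebra_simps)
    qed
    have rt: "\<bar>r (\<gamma> y) + t (\<gamma> y)\<bar> \<le> N" using bd N2(1) by (simp add: N_def)
    have "\<bar>E' y\<bar> \<le> \<bar>4 * (b y)\<^sup>2 * (r (\<gamma> y) + t (\<gamma> y))\<bar> + \<bar>2 * b y * X y\<bar> + \<bar>2 * w\<^sup>2 * X y\<bar> + \<bar>4 * w\<^sup>2 * Q y\<bar>"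
      unfolding E'_def aw(4)[symmetric] by (simp add: algebra_simps power2_eq_square)
    also have "\<bar>4 * (b y)\<^sup>2 * (r (\<gamma> y) + t (\<gamma> y))\<bar> \<le> 4 * a^4 * N"
      unfolding abs_mult a4 using rt by (intro mult_mono) auto
    also have "\<bar>2 * b y * X y\<bar> \<le> 2 * a\<^sup>2 * (sqrt C * a * w)"
      unfolding abs_mult aw(3) using X by (intro mult_mono) auto
    also have "\<bar>2 * w\<^sup>2 * X y\<bar> \<le> 2 * w\<^sup>2 * (sqrt C * a * w)"
      unfolding abs_mult using X by (intro mult_mono) auto
    also have "\<bar>4 * w\<^sup>2 * Q y\<bar> \<le> 4 * w\<^sup>2 * (2 * N * w\<^sup>2)"
      unfolding abs_mult using Q by (intro mult_mono) auto
    finally have "\<bar>E' y\<bar> \<le> 4 * N * a^4 + 2 * sqrt C * (a^3 * w + a * w^3) + 8 * N * w^4"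
      by (simp add: algebra_simps power_numeral_reduce)
    moreover have "a^3 * w + a * w^3 \<le> a^4 + w^4"
    proof -
      have "a^4 + w^4 - (a^3 * w + a * w^3) = (a - w)\<^sup>2 * (a\<^sup>2 + a * w + w\<^sup>2)" by algebra
      also have "\<dots> \<ge> 0" using aw by (intro mult_nonneg_nonneg add_nonneg_nonneg) auto
      finally show ?thesis by simp
    qed
    then have "2 * sqrt C * (a^3 * w + a * w^3) \<le> 4 * sqrt C * (a^4 + w^4)"
      using C(1) aw by (intro mult_mono) auto
    moreover have "0 \<le> 4 * N * a^4" using N1 N2 N3 by (simp add: N_def)
    ultimately show "\<bar>E' y\<bar> \<le> (8 * N + 4 * sqrt C) * E y"
      unfolding E by (simp add: algebra_simps)
  next
    show "E 0 = 0" using assms(1) by (simp add: E_def b_def u_def v_def \<gamma>_def)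
  qed auto
  then have "((u x)\<^sup>2 + (v x)\<^sup>2)\<^sup>2 \<le> 0"
    unfolding E_def using zero_le_power2[of "b x"] by linarith
  then have "(u x)\<^sup>2 + (v x)\<^sup>2 = 0" by (simp only: power2_less_eq_zero_iff)
  then have "u x = 0" "v x = 0" by (auto simp: sum_power2_eq_zero_iff)
  then show "p (z + of_real x * e) = p z" "q (z + of_real x * e) = q z"
    by (auto simp: u_def v_def \<gamma>_def)
qed

end

section \<open>The space-like strip between light-like lines\<close>

context zmc_gradient begin

text \<open>All light-like lines are parallel, so being light-like depends only on a coordinate
  \<open>l\<close> transversal to them. The set \<open>\<Omega>\<close> is the preimage under
  \<open>l\<close> of the component of \<open>l z0\<close> in the complement of the light-like
  values, or the whole plane if there is no light-like point.\<close>

lemma space_like_strip: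
  assumes "\<beta> z0 > 0"
  obtains \<Omega> where "open \<Omega>" "convex \<Omega>" "z0 \<in> \<Omega>" "\<And>z. z \<in> \<Omega> \<Longrightarrow> \<beta> z > 0"
    "\<And>z. z \<in> closure \<Omega> - \<Omega> \<Longrightarrow> \<beta> z = 0"
proof -
  have pos: "\<beta> z > 0" if "convex \<Omega>" "z0 \<in> \<Omega>" "z \<in> \<Omega>" "\<And>y. y \<in> \<Omega> \<Longrightarrow> \<beta> y \<noteq> 0" for \<Omega> z
  proof (rule ccontr)
    assume "\<not> \<beta> z > 0"
    then have "\<exists>y\<in>\<Omega>. \<beta> y = 0"
      using connected_ivt_hyperplane[of "\<beta> ` \<Omega>" "\<beta> z" "\<beta> z0" 1 0] that assms
        connected_continuous_image[OF continuous_\<beta> convex_connected] by fastforce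
    then show False using that(4) by blast
  qed
  show ?thesis
  proof (cases "\<exists>z1. \<beta> z1 = 0")
    case False
    then show ?thesis using pos[of UNIV] by (intro that[of UNIV]) auto
  next
    case True
    then obtain z1 where z1: "\<beta> z1 = 0" by blast
    define e where "e = Complex (p z1) (q z1)"
    have e1: "(Re e)\<^sup>2 + (Im e)\<^sup>2 = 1" using z1 by (simp add: e_def \<beta>_def)
    \<comment> \<open>If \<open>e\<close> and \<open>e'\<close> were independent, the light-like
      lines through \<open>z1\<close> and \<open>w\<close> would meet. The gradient of \<psi> is
      constant along each line, so at the meeting point, found by Cramer's rule, it would equal both
      \<open>e\<close> and \<open>e'\<close>.\<close>
    have invar: "\<beta> (w + of_real x * e) = 0" if w: "\<beta> w = 0" for w x
    proof -
      define e' where "e' = Complex (p w) (q w)"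
      have e1': "(Re e')\<^sup>2 + (Im e')\<^sup>2 = 1" using w by (simp add: e'_def \<beta>_def)
      define \<Delta> where "\<Delta> = Re e * Im e' - Im e * Re e'"
      have "\<Delta> = 0"
      proof (rule ccontr)
        assume \<Delta>: "\<Delta> \<noteq> 0"
        define d where "d = w - z1"
        define x' where "x' = (Re d * Im e' - Im d * Re e') / \<Delta>"
        define y' where "y' = - (Re e * Im d - Im e * Re d) / \<Delta>"
        have "x' * Re e - y' * Re e' = Re d" "x' * Im e - y' * Im e' = Im d"
        proof -
          have "x' * \<Delta> = Re d * Im e' - Im d * Re e'" "y' * \<Delta> = - (Re e * Im d - Im e * Re d)"
            using \<Delta> by (auto simp: x'_def y'_def)
          then have "(x' * Re e - y' * Re e') * \<Delta> = Re d * \<Delta>" "(x' * Im e - y' * Im e') * \<Delta> = Im d * \<Delta>"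
            unfolding \<Delta>_def by algebra+
          then show "x' * Re e - y' * Re e' = Re d" "x' * Im e - y' * Im e' = Im d" using \<Delta> by auto
        qed
        then have "z1 + of_real x' * e = w + of_real y' * e'"
          by (auto simp: complex_eq_iff d_def algebra_simps)
        then have "e = e'"
          using light_like_line[OF z1, of x'] light_like_line[OF w, of y']
          by (simp add: e_def e'_def)
        then show False using \<Delta> by (simp add: \<Delta>_def)
      qed
      \<comment> \<open>Parallel unit vectors: \<open>k\<close> is 1 or -1, so the light-like line
        through \<open>w\<close> also has direction \<open>e\<close>.\<close>
      define k where "k = Re e * Re e' + Im e * Im e'"
      have e: "Re e = k * Re e'" "Im e = k * Im e'"
        using \<open>\<Delta> = 0\<close> e1 e1' unfolding k_def \<Delta>_def by algebra+
      then have "w + of_real x * e = w + of_real (x * k) * e'"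
        by (simp add: complex_eq_iff)
      then show ?thesis
        using light_like_line[OF w, of "x * k"] w by (simp only: e'_def \<beta>_def)
    qed
    \<comment> \<open>\<open>l\<close> is the signed coordinate normal to \<open>e\<close> and
      \<open>\<sigma>\<close> parametrizes the normal line through 0, so
      \<open>\<sigma> (l z)\<close> lies on the line through \<open>z\<close> in direction
      \<open>e\<close>.\<close>
    define l where "l = (\<lambda>z. Re e * Im z - Im e * Re z)"
    define \<sigma> where "\<sigma> = (\<lambda>k. of_real k * Complex (- Im e) (Re e))"
    have decomp: "z = \<sigma> (l z) + of_real (Re e * Re z + Im e * Im z) * e" for z
      using e1 unfolding complex_eq_iff \<sigma>_def l_def by (simp; algebra)
    have zero_iff: "\<beta> z = 0 \<longleftrightarrow> \<beta> (\<sigma> (l z)) = 0" for z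
    proof
      assume "\<beta> z = 0"
      moreover have "\<sigma> (l z) = z + of_real (- (Re e * Re z + Im e * Im z)) * e"
        using decomp[of z] by (simp add: algebra_simps)
      ultimately show "\<beta> (\<sigma> (l z)) = 0" using invar by metis
    next
      assume "\<beta> (\<sigma> (l z)) = 0"
      from invar[OF this] show "\<beta> z = 0" using decomp[of z] by metis
    qed
    define O' where "O' = {k. \<beta> (\<sigma> k) \<noteq> 0}"
    have "continuous_on UNIV (\<lambda>k. \<beta> (\<sigma> k))"
      unfolding \<sigma>_def by (intro continuous_on_compose2[OF continuous_\<beta>] continuous_intros) auto
    then have O': "open O'" unfolding O'_def by (intro open_Collect_neq continuous_intros)
    define I where "I = (\<lambda>c. connected_component_set O' c)"
    define \<Omega> where "\<Omega> = l -` I (l z0)"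
    have lin: "linear l" by (rule linearI) (auto simp: l_def algebra_simps)
    have op: "open (l -` I c)" for c
      unfolding I_def l_def by (intro open_vimage open_connected_component O' continuous_intros)
    have conv: "convex (I c)" for c
      unfolding I_def by (metis connected_connected_component connected_convex_1 connected_component_eq_self
        is_interval_connected_1 is_interval_convex)
    have mem: "c \<in> I c" if "c \<in> O'" for c using that by (simp add: I_def)
    have z0: "l z0 \<in> O'" using assms zero_iff[of z0] by (auto simp: O'_def)
    show ?thesis
    proof (rule that[of \<Omega>])
      show "open \<Omega>" unfolding \<Omega>_def by (rule op)
      show c: "convex \<Omega>" unfolding \<Omega>_def by (intro convex_linear_vimage lin conv)
      show m: "z0 \<in> \<Omega>" using mem[OF z0] by (simp add: \<Omega>_def)
      have "\<beta> z \<noteq> 0" if "z \<in> \<Omega>" for z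
        using that connected_component_subset[of O' "l z0"] zero_iff[of z] by (auto simp: \<Omega>_def I_def O'_def)
      then show "\<beta> z > 0" if "z \<in> \<Omega>" for z using pos[OF c m that] by blast
      show "\<beta> z = 0" if z: "z \<in> closure \<Omega> - \<Omega>" for z
      proof (rule ccontr)
        assume "\<beta> z \<noteq> 0"
        then have lz: "l z \<in> O'" using zero_iff[of z] by (auto simp: O'_def)
        \<comment> \<open>This preimage is an open neighbourhood of \<open>z\<close>. It meets
          \<open>\<Omega>\<close>, so the two components coincide and \<open>z\<close> would lie in
          \<open>\<Omega>\<close>.\<close>
        have "z \<in> l -` I (l z)" using mem[OF lz] by simp
        then obtain y where "y \<in> \<Omega>" "y \<in> l -` I (l z)"
          using z op[of "l z"] by (meson DiffD1 closure_iff_nhds_not_empty disjoint_iff order_refl)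
        then have "I (l z0) = I (l z)"
          unfolding \<Omega>_def I_def by (metis connected_component_eq vimage_eq)
        then show False using z mem[OF lz] by (auto simp: \<Omega>_def)
      qed
    qed
  qed
qed

end

section \<open>Primitives of closed one-forms\<close>

text \<open>The Poincare lemma; closedness is expressed by the shared coefficient \<open>b\<close>.
  The primitive integrates the form along segments from \<open>z0\<close> and is differentiated
  under the integral sign.\<close>

lemma closed_form_has_primitive:
  fixes \<alpha> \<gamma> a b c :: "complex \<Rightarrow> real"
  assumes S: "open S" "convex S"
    and \<alpha>: "\<And>z. z \<in> S \<Longrightarrow> (\<alpha> has_derivative (\<lambda>h. a z * Re h + b z * Im h)) (at z)"
    and \<gamma>: "\<And>z. z \<in> S \<Longrightarrow> (\<gamma> has_derivative (\<lambda>h. b z * Re h + c z * Im h)) (at z)"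
    and cont: "continuous_on S a" "continuous_on S b" "continuous_on S c"
  obtains F where "\<And>z. z \<in> S \<Longrightarrow> (F has_derivative (\<lambda>h. \<alpha> z * Re h + \<gamma> z * Im h)) (at z)"
proof (cases "S = {}")
  case True
  then show ?thesis using that by blast
next
  case False
  then obtain z0 where z0: "z0 \<in> S" by blast
  define \<rho> where "\<rho> = (\<lambda>z (\<tau>::real). z0 + of_real \<tau> * (z - z0))"
  have \<rho>: "\<rho> z \<tau> \<in> S" if "z \<in> S" "\<tau> \<in> {0..1}" for z \<tau>
    using convexD_alt[OF S(2) z0 that(1), of \<tau>] that(2)
    by (simp add: \<rho>_def scaleR_conv_of_real algebra_simps)
  define R where "R = Blinfun Re"
  define J where "J = Blinfun Im"
  have RJ [simp]: "blinfun_apply R h = Re h" "blinfun_apply J h = Im h" for h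
    by (simp_all add: R_def J_def bounded_linear_Blinfun_apply bounded_linear_Re bounded_linear_Im)
  define f where "f = (\<lambda>z \<tau>. \<alpha> (\<rho> z \<tau>) * Re (z - z0) + \<gamma> (\<rho> z \<tau>) * Im (z - z0))"
  \<comment> \<open>\<open>u\<close> and \<open>v\<close> are the coefficients of the derivative of
    \<open>f\<close> in \<open>z\<close>. As the form is closed, they are also the derivatives in
    \<open>\<tau>\<close> of \<open>\<tau> * \<alpha> (\<rho> z \<tau>)\<close> and
    \<open>\<tau> * \<gamma> (\<rho> z \<tau>)\<close>, so their integrals are
    \<open>\<alpha> z\<close> and \<open>\<gamma> z\<close>.\<close>
  define u where "u = (\<lambda>z \<tau>. \<alpha> (\<rho> z \<tau>) + \<tau> * (a (\<rho> z \<tau>) * Re (z - z0) + b (\<rho> z \<tau>) * Im (z - z0)))"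
  define v where "v = (\<lambda>z \<tau>. \<gamma> (\<rho> z \<tau>) + \<tau> * (b (\<rho> z \<tau>) * Re (z - z0) + c (\<rho> z \<tau>) * Im (z - z0)))"
  define f' where "f' = (\<lambda>z \<tau>. u z \<tau> *\<^sub>R R + v z \<tau> *\<^sub>R J)"
  have cont\<alpha>\<gamma>: "continuous_on S \<alpha>" "continuous_on S \<gamma>"
    using \<alpha> \<gamma> has_derivative_continuous by (blast intro: continuous_at_imp_continuous_on)+
  have cont\<rho>: "continuous_on (S \<times> {0..1}) (\<lambda>x. g (\<rho> (fst x) (snd x)))" if "continuous_on S g" for g :: "complex \<Rightarrow> real"
    by (rule continuous_on_compose2[OF that]) (use \<rho> in \<open>auto intro!: continuous_intros simp: \<rho>_def\<close>)
  show ?thesis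
  proof (rule that[of "\<lambda>z. integral (cbox 0 1) (f z)"])
    fix z assume z: "z \<in> S"
    have "((\<lambda>z. integral (cbox 0 1) (f z)) has_derivative integral (cbox 0 1) (f' z)) (at z within S)"
    proof (rule leibniz_rule[OF _ _ _ z S(2)])
      fix w and \<tau> :: real assume w: "w \<in> S" and \<tau>: "\<tau> \<in> cbox 0 1"
      have w': "\<rho> w \<tau> \<in> S" using \<rho> w \<tau> by auto
      have d\<rho>: "((\<lambda>w. \<rho> w \<tau>) has_derivative (\<lambda>h. of_real \<tau> * h)) (at w)"
        unfolding \<rho>_def by (auto intro!: derivative_eq_intros)
      note d1 = has_derivative_compose[OF d\<rho> \<alpha>[OF w']]
      note d2 = has_derivative_compose[OF d\<rho> \<gamma>[OF w']]
      show "((\<lambda>w. f w \<tau>) has_derivative blinfun_apply (f' w \<tau>)) (at w within S)"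
        unfolding f_def
        by (rule has_derivative_at_withinI, (rule derivative_eq_intros d1 d2 refl)+)
          (auto simp: f'_def u_def v_def blinfun.bilinear_simps algebra_simps)
    next
      fix w assume w: "w \<in> S"
      have "continuous_on {0..1} (\<lambda>\<tau>. g (\<rho> w \<tau>))" if "continuous_on S g" for g :: "complex \<Rightarrow> real"
      proof (rule continuous_on_compose2[OF that])
        show "continuous_on {0..1} (\<rho> w)" unfolding \<rho>_def by (intro continuous_intros)
        show "\<rho> w ` {0..1} \<subseteq> S" using \<rho>[OF w] by blast
      qed
      from this[OF cont\<alpha>\<gamma>(1)] this[OF cont\<alpha>\<gamma>(2)] show "f w integrable_on cbox 0 1"
        unfolding f_def cbox_interval by (intro integrable_continuous_real continuous_intros)
    next
      show "continuous_on (S \<times> cbox 0 1) (\<lambda>(z, \<tau>). f' z \<tau>)"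
        unfolding f'_def u_def v_def cbox_interval case_prod_beta
        by (intro continuous_intros cont\<rho> cont\<alpha>\<gamma> cont)
    qed
    moreover have "integral (cbox 0 1) (f' z) = \<alpha> z *\<^sub>R R + \<gamma> z *\<^sub>R J"
    proof -
      have "(f' z has_integral ((1 * \<alpha> (\<rho> z 1)) *\<^sub>R R + (1 * \<gamma> (\<rho> z 1)) *\<^sub>R J)
         - ((0 * \<alpha> (\<rho> z 0)) *\<^sub>R R + (0 * \<gamma> (\<rho> z 0)) *\<^sub>R J)) {0..1}"
      proof (rule fundamental_theorem_of_calculus)
        fix \<tau> :: real assume \<tau>: "\<tau> \<in> {0..1}"
        have z': "\<rho> z \<tau> \<in> S" using \<rho> z \<tau> by auto
        have d\<rho>: "(\<rho> z has_derivative (\<lambda>k. of_real k * (z - z0))) (at \<tau>)"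
          unfolding \<rho>_def by (auto intro!: derivative_eq_intros)
        have d1: "((\<lambda>\<tau>. \<alpha> (\<rho> z \<tau>)) has_real_derivative (a (\<rho> z \<tau>) * Re (z - z0) + b (\<rho> z \<tau>) * Im (z - z0))) (at \<tau>)"
          unfolding has_field_derivative_def
          by (rule has_derivative_eq_rhs[OF has_derivative_compose[OF d\<rho> \<alpha>[OF z']]]) (auto simp: algebra_simps)
        have d2: "((\<lambda>\<tau>. \<gamma> (\<rho> z \<tau>)) has_real_derivative (b (\<rho> z \<tau>) * Re (z - z0) + c (\<rho> z \<tau>) * Im (z - z0))) (at \<tau>)"
          unfolding has_field_derivative_def
          by (rule has_derivative_eq_rhs[OF has_derivative_compose[OF d\<rho> \<gamma>[OF z']]]) (auto simp: algebra_simps)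
        have D1: "((\<lambda>\<tau>. \<tau> * \<alpha> (\<rho> z \<tau>)) has_real_derivative u z \<tau>) (at \<tau>)"
          and D2: "((\<lambda>\<tau>. \<tau> * \<gamma> (\<rho> z \<tau>)) has_real_derivative v z \<tau>) (at \<tau>)"
          unfolding u_def v_def by ((rule derivative_eq_intros d1 d2 refl)+, simp add: algebra_simps)+
        have "((\<lambda>\<tau>. (\<tau> * \<alpha> (\<rho> z \<tau>)) *\<^sub>R R + (\<tau> * \<gamma> (\<rho> z \<tau>)) *\<^sub>R J) has_vector_derivative f' z \<tau>) (at \<tau>)"
          using has_vector_derivative_add[OF
              has_vector_derivative_scaleR[OF D1 has_vector_derivative_const[of R]]
              has_vector_derivative_scaleR[OF D2 has_vector_derivative_const[of J]]]
          by (simp add: f'_def)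
        then show "((\<lambda>\<tau>. (\<tau> * \<alpha> (\<rho> z \<tau>)) *\<^sub>R R + (\<tau> * \<gamma> (\<rho> z \<tau>)) *\<^sub>R J) has_vector_derivative f' z \<tau>) (at \<tau> within {0..1})"
          by (rule has_vector_derivative_at_within)
      qed auto
      then show ?thesis by (simp add: \<rho>_def cbox_interval integral_unique)
    qed
    ultimately have "((\<lambda>z. integral (cbox 0 1) (f z)) has_derivative blinfun_apply (\<alpha> z *\<^sub>R R + \<gamma> z *\<^sub>R J)) (at z)"
      using at_within_open[OF z S(1)] by simp
    then show "((\<lambda>z. integral (cbox 0 1) (f z)) has_derivative (\<lambda>h. \<alpha> z * Re h + \<gamma> z * Im h)) (at z)"
      by (rule has_derivative_eq_rhs) (auto simp: blinfun.bilinear_simps)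
  qed
qed

section \<open>The flat chart\<close>

lemma has_gradient_divide:
  fixes f g :: "complex \<Rightarrow> real"
  assumes f: "(f has_derivative (\<lambda>h. a * Re h + c * Im h)) (at z)"
    and g: "(g has_derivative (\<lambda>h. a' * Re h + c' * Im h)) (at z)" and nz: "g z \<noteq> 0"
  shows "((\<lambda>z. f z / g z) has_derivative (\<lambda>h. (a * g z - f z * a') / (g z)\<^sup>2 * Re h
    + (c * g z - f z * c') / (g z)\<^sup>2 * Im h)) (at z)"
proof (rule has_derivative_eq_rhs[OF has_derivative_divide'[OF f g nz]], rule ext)
  fix h
  have "((a * Re h + c * Im h) * g z - f z * (a' * Re h + c' * Im h))
      = (a * g z - f z * a') * Re h + (c * g z - f z * c') * Im h"
    by algebra
  then show "((a * Re h + c * Im h) * g z - f z * (a' * Re h + c' * Im h)) / (g z * g z)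
      = (a * g z - f z * a') / (g z)\<^sup>2 * Re h + (c * g z - f z * c') / (g z)\<^sup>2 * Im h"
    by (simp add: add_divide_distrib power2_eq_square)
qed

context zmc_gradient begin

text \<open>\<open>flat z\<close> is the differential of the flat chart and \<open>unflat z\<close> its inverse; in terms of the
  Gauss map \<open>g = (p + i q) / (1 + b)\<close> the latter is \<open>h \<mapsto> (h + g\<^sup>2 cnj h) / 2\<close>.\<close>

definition "b = (\<lambda>z. sqrt (\<beta> z))"
definition "b\<^sub>x = (\<lambda>z. - (p z * r z + q z * s z) / b z)"
definition "b\<^sub>y = (\<lambda>z. - (p z * s z + q z * t z) / b z)"
text \<open>The symmetric matrix with diagonal \<open>n\<^sub>2\<close>, \<open>n\<^sub>1\<close>
  and off-diagonal entry \<open>- m\<close> is \<open>b\<close> times the identity plus the induced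
  metric \<open>dx^2 + dy^2 - d\<psi>^2\<close>.\<close>

definition "m = (\<lambda>z. p z * q z)"
definition "n\<^sub>1 = (\<lambda>z. b z + 1 - (q z)\<^sup>2)"
definition "n\<^sub>2 = (\<lambda>z. b z + 1 - (p z)\<^sup>2)"

definition "flat z h = Complex ((n\<^sub>2 z * Re h - m z * Im h) / b z) ((n\<^sub>1 z * Im h - m z * Re h) / b z)"

definition "unflat z h = Complex ((n\<^sub>1 z * Re h + m z * Im h) / (1 + b z)\<^sup>2) ((m z * Re h + n\<^sub>2 z * Im h) / (1 + b z)\<^sup>2)"

lemma b_pos: "\<beta> z > 0 \<Longrightarrow> b z > 0" and b_square: "\<beta> z > 0 \<Longrightarrow> (b z)\<^sup>2 = 1 - (p z)\<^sup>2 - (q z)\<^sup>2"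
  by (auto simp: b_def \<beta>_def)

text \<open>The induced metric has determinant \<open>b^2\<close> and trace \<open>1 + b^2\<close>;
  adding \<open>b\<close> times the identity gives the determinant
  \<open>b^2 + b * (1 + b^2) + b^2\<close>.\<close>

lemma n_det: "\<beta> z > 0 \<Longrightarrow> n\<^sub>1 z * n\<^sub>2 z - (m z)\<^sup>2 = b z * (1 + b z)\<^sup>2"
  using b_square[of z] unfolding n\<^sub>1_def n\<^sub>2_def m_def by algebra

lemma flat_unflat: assumes "\<beta> z > 0" shows "flat z (unflat z h) = h"
proof -
  have "b z > 0" using b_pos[OF assms] .
  then have nz: "b z \<noteq> 0" "(1 + b z)\<^sup>2 \<noteq> 0" by auto
  have "n\<^sub>2 z * (n\<^sub>1 z * Re h + m z * Im h) - m z * (m z * Re h + n\<^sub>2 z * Im h) = b z * (1 + b z)\<^sup>2 * Re h"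
    "n\<^sub>1 z * (m z * Re h + n\<^sub>2 z * Im h) - m z * (n\<^sub>1 z * Re h + m z * Im h) = b z * (1 + b z)\<^sup>2 * Im h"
    using n_det[OF assms] by algebra+
  then show ?thesis
    using nz by (simp add: flat_def unflat_def complex_eq_iff divide_simps)
qed

text \<open>\<open>flat z\<close> is the identity plus the induced metric divided by
  \<open>b z\<close>, and that metric is nonnegative by the Cauchy-Schwarz inequality, since the
  gradient of \<psi> has length at most 1.\<close>

lemma flat_expanding: assumes "\<beta> z > 0" shows "flat z h \<bullet> h \<ge> h \<bullet> h"
proof -
  have b: "b z > 0" using b_pos[OF assms] .
  have "(p z)\<^sup>2 + (q z)\<^sup>2 \<le> 1" using assms by (simp add: \<beta>_def)
  have "(p z * Re h + q z * Im h)\<^sup>2 \<le> ((p z)\<^sup>2 + (q z)\<^sup>2) * ((Re h)\<^sup>2 + (Im h)\<^sup>2)"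
  proof -
    have "((p z)\<^sup>2 + (q z)\<^sup>2) * ((Re h)\<^sup>2 + (Im h)\<^sup>2) - (p z * Re h + q z * Im h)\<^sup>2 = (p z * Im h - q z * Re h)\<^sup>2"
      by algebra
    then show ?thesis by (metis diff_ge_0_iff_ge zero_le_power2)
  qed
  also have "\<dots> \<le> 1 * ((Re h)\<^sup>2 + (Im h)\<^sup>2)"
    using \<open>(p z)\<^sup>2 + (q z)\<^sup>2 \<le> 1\<close> by (intro mult_right_mono) auto
  finally have "0 \<le> ((Re h)\<^sup>2 + (Im h)\<^sup>2 - (p z * Re h + q z * Im h)\<^sup>2) / b z" using b by simp
  also have "\<dots> = flat z h \<bullet> h - h \<bullet> h"
    using b by (simp add: flat_def inner_complex_def n\<^sub>1_def n\<^sub>2_def m_def field_simps power2_eq_square)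
  finally show ?thesis by simp
qed

lemma b_der:
  assumes "\<beta> z > 0"
  shows "(b has_derivative (\<lambda>h. b\<^sub>x z * Re h + b\<^sub>y z * Im h)) (at z)"
proof -
  have "(b has_derivative (\<lambda>h. (\<beta>x z * Re h + \<beta>y z * Im h) / (2 * b z))) (at z)"
    unfolding b_def
    by (rule has_derivative_eq_rhs[OF has_derivative_compose[OF \<beta>_der has_derivative_real_sqrt[OF assms has_derivative_ident]]])
      (simp add: field_simps)
  then show ?thesis
    by (rule has_derivative_eq_rhs)
      (use b_pos[OF assms] in \<open>auto simp: fun_eq_iff \<beta>x_def \<beta>y_def b\<^sub>x_def b\<^sub>y_def field_simps\<close>)
qed

lemma n\<^sub>1_der:
  assumes "\<beta> z > 0"
  shows "(n\<^sub>1 has_derivative (\<lambda>h. (b\<^sub>x z - 2 * q z * s z) * Re h + (b\<^sub>y z - 2 * q z * t z) * Im h)) (at z)"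
  unfolding n\<^sub>1_def power2_eq_square
  by (rule has_derivative_eq_rhs[OF has_derivative_diff[OF has_derivative_add[OF b_der[OF assms]
    has_derivative_const] has_derivative_mult[OF q_der q_der]]]) (simp add: algebra_simps)

lemma n\<^sub>2_der:
  assumes "\<beta> z > 0"
  shows "(n\<^sub>2 has_derivative (\<lambda>h. (b\<^sub>x z - 2 * p z * r z) * Re h + (b\<^sub>y z - 2 * p z * s z) * Im h)) (at z)"
  unfolding n\<^sub>2_def power2_eq_square
  by (rule has_derivative_eq_rhs[OF has_derivative_diff[OF has_derivative_add[OF b_der[OF assms]
    has_derivative_const] has_derivative_mult[OF p_der p_der]]]) (simp add: algebra_simps)

lemma minus_m_der:
  "((\<lambda>z. - m z) has_derivative (\<lambda>h. - (r z * q z + p z * s z) * Re h + - (s z * q z + p z * t z) * Im h)) (at z)"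
  unfolding m_def
  by (rule has_derivative_eq_rhs[OF has_derivative_minus[OF has_derivative_mult[OF p_der q_der]]])
    (simp add: algebra_simps)

lemma b_times_gradient:
  assumes "\<beta> z > 0"
  shows "b z * b\<^sub>x z = - (p z * r z + q z * s z)" "b z * b\<^sub>y z = - (p z * s z + q z * t z)"
  using b_pos[OF assms] by (simp_all add: b\<^sub>x_def b\<^sub>y_def)

text \<open>The two rows of \<open>flat\<close> are one-forms that are closed by the zero mean
  curvature equation; their primitives are the real and imaginary parts of the chart.\<close>

lemma flat_chart:
  assumes \<Omega>: "open \<Omega>" "convex \<Omega>" "\<And>z. z \<in> \<Omega> \<Longrightarrow> \<beta> z > 0"
  obtains T where "\<And>z. z \<in> \<Omega> \<Longrightarrow> (T has_derivative flat z) (at z)"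
proof -
  have contb: "continuous_on \<Omega> b"
    unfolding b_def by (intro continuous_intros continuous_\<beta>)
  have b: "b z > 0" "b z \<noteq> 0" if "z \<in> \<Omega>" for z using b_pos[OF \<Omega>(3)[OF that]] by auto
  note cont = continuous_intros contb continuous_p continuous_q continuous_r continuous_s continuous_t
  define a\<^sub>1 where "a\<^sub>1 = (\<lambda>z. ((b\<^sub>x z - 2 * p z * r z) * b z - n\<^sub>2 z * b\<^sub>x z) / (b z)\<^sup>2)"
  define a\<^sub>2 where "a\<^sub>2 = (\<lambda>z. ((b\<^sub>y z - 2 * p z * s z) * b z - n\<^sub>2 z * b\<^sub>y z) / (b z)\<^sup>2)"
  define a\<^sub>3 where "a\<^sub>3 = (\<lambda>z. ((b\<^sub>x z - 2 * q z * s z) * b z - n\<^sub>1 z * b\<^sub>x z) / (b z)\<^sup>2)"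
  define a\<^sub>4 where "a\<^sub>4 = (\<lambda>z. ((b\<^sub>y z - 2 * q z * t z) * b z - n\<^sub>1 z * b\<^sub>y z) / (b z)\<^sup>2)"
  \<comment> \<open>For each form the \<open>y\<close>-derivative of the first coefficient is the
    \<open>x\<close>-derivative of the second. The extra factor \<open>b z\<close> in the proof
    removes the denominators of \<open>b\<^sub>x\<close> and \<open>b\<^sub>y\<close>, leaving
    polynomial identities.\<close>
  have closed: "a\<^sub>2 z = (- (r z * q z + p z * s z) * b z - (- m z) * b\<^sub>x z) / (b z)\<^sup>2"
    "a\<^sub>3 z = (- (s z * q z + p z * t z) * b z - (- m z) * b\<^sub>y z) / (b z)\<^sup>2" if "z \<in> \<Omega>" for z
  proof -
    note * = b_times_gradient[OF \<Omega>(3)[OF that]] b_square[OF \<Omega>(3)[OF that]] zmc[of z]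
    have "b z * ((b\<^sub>y z - 2 * p z * s z) * b z - n\<^sub>2 z * b\<^sub>y z)
        = b z * (- (r z * q z + p z * s z) * b z - (- m z) * b\<^sub>x z)"
      "b z * ((b\<^sub>x z - 2 * q z * s z) * b z - n\<^sub>1 z * b\<^sub>x z)
        = b z * (- (s z * q z + p z * t z) * b z - (- m z) * b\<^sub>y z)"
      using * unfolding n\<^sub>1_def n\<^sub>2_def m_def by algebra+
    then show "a\<^sub>2 z = (- (r z * q z + p z * s z) * b z - (- m z) * b\<^sub>x z) / (b z)\<^sup>2"
      "a\<^sub>3 z = (- (s z * q z + p z * t z) * b z - (- m z) * b\<^sub>y z) / (b z)\<^sup>2"
      using b[OF that] unfolding a\<^sub>2_def a\<^sub>3_def by (metis mult_cancel_left)+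
  qed
  have d1: "((\<lambda>z. n\<^sub>2 z / b z) has_derivative (\<lambda>h. a\<^sub>1 z * Re h + a\<^sub>2 z * Im h)) (at z)" if "z \<in> \<Omega>" for z
    unfolding a\<^sub>1_def a\<^sub>2_def
    by (rule has_gradient_divide[OF n\<^sub>2_der b_der]) (use \<Omega>(3) b that in auto)
  have d3: "((\<lambda>z. n\<^sub>1 z / b z) has_derivative (\<lambda>h. a\<^sub>3 z * Re h + a\<^sub>4 z * Im h)) (at z)" if "z \<in> \<Omega>" for z
    unfolding a\<^sub>3_def a\<^sub>4_def
    by (rule has_gradient_divide[OF n\<^sub>1_der b_der]) (use \<Omega>(3) b that in auto)
  have d2: "((\<lambda>z. - m z / b z) has_derivative (\<lambda>h. a\<^sub>2 z * Re h + a\<^sub>3 z * Im h)) (at z)" if "z \<in> \<Omega>" for z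
    unfolding closed[OF that]
    by (rule has_gradient_divide[OF minus_m_der b_der]) (use \<Omega>(3) b that in auto)
  have c: "continuous_on \<Omega> a\<^sub>1" "continuous_on \<Omega> a\<^sub>2" "continuous_on \<Omega> a\<^sub>3" "continuous_on \<Omega> a\<^sub>4"
    unfolding a\<^sub>1_def a\<^sub>2_def a\<^sub>3_def a\<^sub>4_def b\<^sub>x_def b\<^sub>y_def n\<^sub>1_def n\<^sub>2_def using b by (intro cont; simp)+
  obtain F where F: "\<And>z. z \<in> \<Omega> \<Longrightarrow> (F has_derivative (\<lambda>h. n\<^sub>2 z / b z * Re h + - m z / b z * Im h)) (at z)"
    using closed_form_has_primitive[OF \<Omega>(1,2), where \<alpha> = "\<lambda>z. n\<^sub>2 z / b z" and \<gamma> = "\<lambda>z. - m z / b z"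
        and a = a\<^sub>1 and b = a\<^sub>2 and c = a\<^sub>3] d1 d2 c by blast
  obtain G where G: "\<And>z. z \<in> \<Omega> \<Longrightarrow> (G has_derivative (\<lambda>h. - m z / b z * Re h + n\<^sub>1 z / b z * Im h)) (at z)"
    using closed_form_has_primitive[OF \<Omega>(1,2), where \<alpha> = "\<lambda>z. - m z / b z" and \<gamma> = "\<lambda>z. n\<^sub>1 z / b z"
        and a = a\<^sub>2 and b = a\<^sub>3 and c = a\<^sub>4] d2 d3 c by blast
  show ?thesis
  proof (rule that[of "\<lambda>z. of_real (F z) + \<i> * of_real (G z)"])
    fix z assume z: "z \<in> \<Omega>"
    show "((\<lambda>z. of_real (F z) + \<i> * of_real (G z)) has_derivative flat z) (at z)"
      by (rule has_derivative_eq_rhs, (rule derivative_eq_intros F[OF z] G[OF z] refl)+)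
        (auto simp: fun_eq_iff complex_eq_iff flat_def diff_divide_distrib)
  qed
qed

text \<open>The mean value theorem is applied along the segment to the component of \<open>T\<close>
  in the direction \<open>x - y\<close>; then \<open>flat_expanding\<close> and the Cauchy-Schwarz
  inequality conclude.\<close>

lemma flat_chart_expanding:
  assumes \<Omega>: "convex \<Omega>" "\<And>z. z \<in> \<Omega> \<Longrightarrow> \<beta> z > 0"
    and T: "\<And>z. z \<in> \<Omega> \<Longrightarrow> (T has_derivative flat z) (at z)"
    and xy: "x \<in> \<Omega>" "y \<in> \<Omega>"
  shows "cmod (x - y) \<le> cmod (T x - T y)"
proof -
  define \<gamma> where "\<gamma> = (\<lambda>\<tau>::real. y + of_real \<tau> * (x - y))"
  have \<gamma>: "\<gamma> \<tau> \<in> \<Omega>" if "0 \<le> \<tau>" "\<tau> \<le> 1" for \<tau>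
    using convexD_alt[OF \<Omega>(1) xy(2,1), of \<tau>] that
    by (simp add: \<gamma>_def scaleR_conv_of_real algebra_simps)
  have d\<gamma>: "(\<gamma> has_derivative (\<lambda>k. of_real k * (x - y))) (at \<tau>)" for \<tau>
    unfolding \<gamma>_def by (auto intro!: derivative_eq_intros)
  have der: "((\<lambda>\<tau>. T (\<gamma> \<tau>) \<bullet> (x - y)) has_derivative (\<lambda>k. flat (\<gamma> \<tau>) (of_real k * (x - y)) \<bullet> (x - y))) (at \<tau> within {0..1})"
    if "0 \<le> \<tau>" "\<tau> \<le> 1" for \<tau>
    by (rule has_derivative_at_withinI, rule has_derivative_inner_left,
      rule has_derivative_compose[OF d\<gamma> T], rule \<gamma>[OF that])
  have "\<exists>\<tau>\<in>{0<..<1}. T (\<gamma> 1) \<bullet> (x - y) - T (\<gamma> 0) \<bullet> (x - y)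
      = flat (\<gamma> \<tau>) (of_real (1 - 0) * (x - y)) \<bullet> (x - y)"
    by (rule mvt_simple) (simp, rule der)
  then obtain \<tau> where \<tau>: "\<tau> \<in> {0<..<1}"
    and "T (\<gamma> 1) \<bullet> (x - y) - T (\<gamma> 0) \<bullet> (x - y) = flat (\<gamma> \<tau>) (of_real (1 - 0) * (x - y)) \<bullet> (x - y)"
    by blast
  then have "(T x - T y) \<bullet> (x - y) = flat (\<gamma> \<tau>) (x - y) \<bullet> (x - y)"
    by (simp add: \<gamma>_def inner_diff_left)
  also have "\<dots> \<ge> (x - y) \<bullet> (x - y)"
    using flat_expanding \<Omega>(2)[OF \<gamma>] \<tau> by auto
  finally have "cmod (x - y) * cmod (x - y) \<le> cmod (T x - T y) * cmod (x - y)"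
    using norm_cauchy_schwarz[of "T x - T y" "x - y"] by (simp add: dot_square_norm power2_eq_square)
  then show ?thesis by (cases "x = y") auto
qed

end

section \<open>Completeness and surjectivity of the flat chart\<close>

context zmc_gradient begin

text \<open>This bounds the derivative of \<open>log \<beta>\<close> in the chart. Up to the factor
  \<open>(1 + b)^2\<close>, \<open>unflat z v\<close> is \<open>b * (1 + b) * v\<close> plus a
  multiple of the gradient of \<psi>. The gradient of \<open>\<beta>\<close> has size at most
  \<open>sqrt C * b\<close>, which handles the first part; \<open>\<beta>_transport\<close> handles
  the second.\<close>

lemma unflat_\<beta>_bound:
  obtains K where "K \<ge> 0" "\<And>z v. z \<in> cball 0 R \<Longrightarrow> \<beta> z > 0 \<Longrightarrow>
    \<bar>\<beta>x z * Re (unflat z v) + \<beta>y z * Im (unflat z v)\<bar> \<le> K * cmod v * \<beta> z"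
proof -
  obtain C where C: "C \<ge> 0" "\<And>z. z \<in> cball 0 R \<Longrightarrow> (\<beta>x z)\<^sup>2 + (\<beta>y z)\<^sup>2 \<le> C * \<bar>\<beta> z\<bar>"
    using gradient_bound[OF \<beta>_der C1_\<beta>x C1_\<beta>y \<beta>_zero, where R = R] by blast
  have "continuous_on UNIV (\<lambda>z. r z + t z)" by (intro continuous_intros continuous_r continuous_t)
  then obtain N where N: "N \<ge> 0" "\<And>z. z \<in> cball 0 R \<Longrightarrow> \<bar>r z + t z\<bar> \<le> N"
    using bounded_on_cball[where R = R] by blast
  show ?thesis
  proof (rule that[of "sqrt C + 2 * N"])
    fix z v assume z: "z \<in> cball 0 R" and pos: "\<beta> z > 0"
    have b: "b z > 0" "(b z)\<^sup>2 = 1 - (p z)\<^sup>2 - (q z)\<^sup>2" "\<beta> z = (b z)\<^sup>2"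
      using b_pos[OF pos] b_square[OF pos] by (auto simp: \<beta>_def)
    define X where "X = \<beta>x z * Re v + \<beta>y z * Im v"
    define Y where "Y = p z * Re v + q z * Im v"
    have n: "n\<^sub>1 z = b z * (1 + b z) + (p z)\<^sup>2" "n\<^sub>2 z = b z * (1 + b z) + (q z)\<^sup>2"
      using b(2) unfolding n\<^sub>1_def n\<^sub>2_def by algebra+
    have "\<beta>x z * (n\<^sub>1 z * Re v + m z * Im v) + \<beta>y z * (m z * Re v + n\<^sub>2 z * Im v)
        = b z * (1 + b z) * X + 2 * \<beta> z * (r z + t z) * Y"
      unfolding \<beta>_transport[symmetric] n m_def X_def Y_def by algebra
    then have eq: "\<beta>x z * Re (unflat z v) + \<beta>y z * Im (unflat z v)
        = (b z * (1 + b z) * X + 2 * \<beta> z * (r z + t z) * Y) / (1 + b z)\<^sup>2"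
      unfolding unflat_def by (simp add: times_divide_eq_right flip: add_divide_distrib)
    have cs: "\<bar>x * Re v + y * Im v\<bar> \<le> sqrt (x\<^sup>2 + y\<^sup>2) * cmod v" for x y
      using Cauchy_Schwarz_ineq2[of "Complex x y" v] by (simp add: inner_complex_def complex_norm)
    have "sqrt ((\<beta>x z)\<^sup>2 + (\<beta>y z)\<^sup>2) \<le> sqrt (C * (b z)\<^sup>2)"
      using C(2)[OF z] pos b(3) by (intro real_sqrt_le_mono) simp
    also have "\<dots> = sqrt C * b z" using b(1) by (simp add: real_sqrt_mult)
    finally have X: "\<bar>X\<bar> \<le> sqrt C * b z * cmod v"
      unfolding X_def by (rule order_trans[OF cs mult_right_mono]) auto
    have "sqrt ((p z)\<^sup>2 + (q z)\<^sup>2) \<le> 1" using b(2) zero_le_power2[of "b z"] by simp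
    then have Y: "\<bar>Y\<bar> \<le> cmod v"
      unfolding Y_def by (intro order_trans[OF cs]) (auto intro: mult_left_le_one_le)
    have "\<bar>b z * (1 + b z) * X\<bar> \<le> b z * (1 + b z)\<^sup>2 * (sqrt C * b z * cmod v)"
    proof -
      have "b z * (1 + b z) * 1 \<le> b z * (1 + b z) * (1 + b z)" using b(1) by (intro mult_left_mono) auto
      then show ?thesis
        unfolding abs_mult[of _ X] using X b(1) by (intro mult_mono) (auto simp: power2_eq_square mult_ac)
    qed
    moreover have "\<bar>2 * \<beta> z * (r z + t z) * Y\<bar> \<le> (1 + b z)\<^sup>2 * (2 * \<beta> z * N * cmod v)"
    proof -
      have "\<bar>2 * \<beta> z * (r z + t z) * Y\<bar> \<le> 2 * \<beta> z * N * cmod v"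
        unfolding abs_mult using N(2)[OF z] N(1) Y pos by (intro mult_mono) auto
      also have "\<dots> \<le> (1 + b z)\<^sup>2 * (2 * \<beta> z * N * cmod v)"
        using mult_right_mono[of 1 "(1 + b z)\<^sup>2" "2 * \<beta> z * N * cmod v"] one_le_power[of "1 + b z" 2]
          b(1) pos N(1) by simp
      finally show ?thesis .
    qed
    ultimately have "\<bar>b z * (1 + b z) * X + 2 * \<beta> z * (r z + t z) * Y\<bar>
        \<le> (1 + b z)\<^sup>2 * ((sqrt C + 2 * N) * cmod v * \<beta> z)"
      unfolding b(3) by (simp add: algebra_simps power2_eq_square)
    then show "\<bar>\<beta>x z * Re (unflat z v) + \<beta>y z * Im (unflat z v)\<bar> \<le> (sqrt C + 2 * N) * cmod v * \<beta> z"
      unfolding eq abs_divide using b(1) by (simp add: divide_le_eq mult_ac)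
  qed (use C N in auto)
qed

lemma flat_chart_inverse:
  assumes \<Omega>: "open \<Omega>" "\<And>z. z \<in> \<Omega> \<Longrightarrow> \<beta> z > 0"
    and T: "\<And>z. z \<in> \<Omega> \<Longrightarrow> (T has_derivative flat z) (at z)"
    and g: "\<And>z. z \<in> \<Omega> \<Longrightarrow> g (T z) = z" and z: "z \<in> \<Omega>"
  shows "(g has_derivative unflat z) (at (T z))"
proof (rule has_derivative_inverse_strong[OF \<Omega>(1) z _ g T[OF z]])
  show "continuous_on \<Omega> T"
    using T has_derivative_continuous by (blast intro: continuous_at_imp_continuous_on)
qed (use flat_unflat \<Omega>(2) z in auto)

text \<open>Otherwise some point of the image sees a nearest point \<open>w\<close> outside. The segment between them, pulled back by \<open>T\<close>,
  has finite length, and \<open>log \<beta>\<close> has bounded derivative along it, so it cannot run into the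
  frontier of \<open>\<Omega>\<close>.\<close>

lemma flat_chart_surj:
  assumes \<Omega>: "open \<Omega>" "convex \<Omega>" "\<Omega> \<noteq> {}" "\<And>z. z \<in> \<Omega> \<Longrightarrow> \<beta> z > 0"
    and frontier: "\<And>z. z \<in> closure \<Omega> - \<Omega> \<Longrightarrow> \<beta> z = 0"
    and T: "\<And>z. z \<in> \<Omega> \<Longrightarrow> (T has_derivative flat z) (at z)"
  shows "T ` \<Omega> = UNIV"
proof (rule ccontr)
  assume not_surj: "T ` \<Omega> \<noteq> UNIV"
  have contT: "continuous_on \<Omega> T"
    using T has_derivative_continuous by (blast intro: continuous_at_imp_continuous_on)
  have expand: "cmod (x - y) \<le> cmod (T x - T y)" if "x \<in> \<Omega>" "y \<in> \<Omega>" for x y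
    by (rule flat_chart_expanding[OF \<Omega>(2,4) T that])
  then have inj: "inj_on T \<Omega>" by (force simp: inj_on_def)
  have opT: "open (T ` \<Omega>)" by (rule invariance_of_domain[OF contT \<Omega>(1) inj])
  define g where "g = inv_into \<Omega> T"
  have gT: "g (T z) = z" if "z \<in> \<Omega>" for z using inj that by (simp add: g_def)
  have g: "g w \<in> \<Omega>" "T (g w) = w" if "w \<in> T ` \<Omega>" for w
    using that by (auto simp: gT)
  obtain w0 where w0: "w0 \<in> T ` \<Omega>" using \<Omega>(3) by blast
  obtain w where w: "w \<in> - (T ` \<Omega>)" and near: "\<And>w'. w' \<in> - (T ` \<Omega>) \<Longrightarrow> dist w0 w \<le> dist w0 w'"
    using distance_attains_inf[OF closed_Compl[OF opT], of w0] not_surj by blast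
  define v where "v = w - w0"
  define c where "c = (\<lambda>\<tau>. w0 + of_real \<tau> * v)"
  have "v \<noteq> 0" using w w0 by (auto simp: v_def)
  \<comment> \<open>A point of the segment before its end is closer to \<open>w0\<close> than
    \<open>w\<close> is, so minimality puts it in the image.\<close>
  have c: "c \<tau> \<in> T ` \<Omega>" if "0 \<le> \<tau>" "\<tau> < 1" for \<tau>
  proof (rule ccontr)
    assume "c \<tau> \<notin> T ` \<Omega>"
    then have "dist w0 w \<le> dist w0 (c \<tau>)" using near by simp
    then have "cmod v \<le> \<tau> * cmod v" using that by (simp add: c_def v_def dist_norm norm_mult norm_minus_commute)
    then show False using that \<open>v \<noteq> 0\<close> by simp
  qed
  \<comment> \<open>As \<open>T\<close> is expanding, \<open>g\<close> does not increase distances,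
    so the pulled-back segment stays in this disc.\<close>
  define \<rho> where "\<rho> = cmod (g w0) + cmod v"
  have in_ball: "g (c \<tau>) \<in> cball 0 \<rho>" if "0 \<le> \<tau>" "\<tau> < 1" for \<tau>
  proof -
    have "cmod (g (c \<tau>) - g w0) \<le> cmod (c \<tau> - w0)"
      using expand[OF g(1)[OF c[OF that]] g(1)[OF w0]] g(2) c[OF that] w0 by simp
    also have "\<dots> \<le> cmod v"
      using that by (simp add: c_def norm_mult mult_left_le_one_le)
    finally show ?thesis
      using norm_triangle_ineq2[of "g (c \<tau>)" "g w0"] by (simp add: \<rho>_def)
  qed
  obtain K where K: "K \<ge> 0" "\<And>z v. z \<in> cball 0 \<rho> \<Longrightarrow> \<beta> z > 0 \<Longrightarrow>
    \<bar>\<beta>x z * Re (unflat z v) + \<beta>y z * Im (unflat z v)\<bar> \<le> K * cmod v * \<beta> z"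
    using unflat_\<beta>_bound[where R = \<rho>] by blast
  define L where "L = K * cmod v"
  define \<delta> where "\<delta> = \<beta> (g w0) * exp (- L)"
  have "\<delta> > 0" using \<Omega>(4) g(1)[OF w0] by (simp add: \<delta>_def)
  have lower: "\<beta> (g (c \<tau>)) \<ge> \<delta>" if \<tau>: "0 \<le> \<tau>" "\<tau> < 1" for \<tau>
  proof -
    \<comment> \<open>\<open>L\<close> bounds the derivative of \<open>log \<beta>\<close> along the
      path, so the product with \<open>exp (L * \<tau>)\<close> is nondecreasing.\<close>
    have "\<beta> (g (c 0)) * exp (L * 0) \<le> \<beta> (g (c \<tau>)) * exp (L * \<tau>)"
    proof (rule DERIV_nonneg_imp_nondecreasing[OF \<tau>(1)])
      fix y assume y: "0 \<le> y" "y \<le> \<tau>"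
      then have y1: "y < 1" using \<tau> by simp
      define z where "z = g (c y)"
      have z: "z \<in> \<Omega>" "c y = T z" using g[OF c[OF y(1) y1]] by (auto simp: z_def)
      have dc: "(c has_derivative (\<lambda>k. of_real k * v)) (at y)"
        unfolding c_def by (auto intro!: derivative_eq_intros)
      have dg: "(g has_derivative unflat z) (at (c y))"
        using flat_chart_inverse[OF \<Omega>(1,4) T gT z(1)] z(2) by simp
      define D where "D = \<beta>x z * Re (unflat z v) + \<beta>y z * Im (unflat z v)"
      have d\<beta>: "(\<beta> has_derivative (\<lambda>h. \<beta>x z * Re h + \<beta>y z * Im h)) (at (g (c y)))"
        using \<beta>_der[of z] by (simp add: z_def)
      have "((\<lambda>y. \<beta> (g (c y))) has_real_derivative D) (at y)"
        unfolding has_field_derivative_def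
        by (rule has_derivative_eq_rhs[OF has_derivative_compose[OF has_derivative_compose[OF dc dg] d\<beta>]])
          (auto simp: D_def unflat_def fun_eq_iff add_divide_distrib algebra_simps)
      then have "((\<lambda>y. \<beta> (g (c y)) * exp (L * y)) has_real_derivative (D + L * \<beta> z) * exp (L * y)) (at y)"
        by (rule DERIV_cong[OF DERIV_mult[OF _ DERIV_fun_exp[OF DERIV_cmult_Id]]])
          (simp add: z_def algebra_simps)
      moreover have "(D + L * \<beta> z) * exp (L * y) \<ge> 0"
        using K(2)[OF in_ball[OF y(1) y1], of v] \<Omega>(4)[OF z(1)]
        by (intro mult_nonneg_nonneg) (auto simp: D_def L_def z_def)
      ultimately show "\<exists>d. ((\<lambda>y. \<beta> (g (c y)) * exp (L * y)) has_real_derivative d) (at y) \<and> 0 \<le> d"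
        by blast
    qed
    also have "\<dots> \<le> \<beta> (g (c \<tau>)) * exp L"
      using \<Omega>(4)[OF g(1)[OF c[OF \<tau>]]] \<tau> K(1) by (intro mult_left_mono) (auto simp: L_def mult_left_le)
    finally show ?thesis
      by (simp add: \<delta>_def c_def exp_minus field_simps)
  qed
  \<comment> \<open>The parameters tend to 1 from below. A subsequence of the pulled-back points
    converges to some \<open>z\<close> with \<open>\<beta> z \<ge> \<delta>\<close>, which excludes
    the frontier; continuity of \<open>T\<close> then gives \<open>T z = w\<close>.\<close>
  define \<tau> where "\<tau> = (\<lambda>n. 1 - inverse (real (Suc n)))"
  have \<tau>: "0 \<le> \<tau> n" "\<tau> n < 1" for n
    by (auto simp: \<tau>_def inverse_le_1_iff)
  have \<tau>_lim: "\<tau> \<longlonglongrightarrow> 1"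
    unfolding \<tau>_def using tendsto_diff[OF tendsto_const LIMSEQ_inverse_real_of_nat, of 1] by simp
  have "\<forall>n. g (c (\<tau> n)) \<in> cball 0 \<rho>" using in_ball \<tau> by blast
  then obtain z k where k: "strict_mono k" and lim: "((\<lambda>n. g (c (\<tau> n))) \<circ> k) \<longlonglongrightarrow> z"
    using compact_cball[of 0 \<rho>, unfolded compact_def] by (metis (mono_tags, lifting))
  have "((\<lambda>n. \<beta> (g (c (\<tau> n)))) \<circ> k) \<longlonglongrightarrow> \<beta> z"
    using continuous_on_tendsto_compose[OF continuous_\<beta>[of UNIV] lim] by (simp add: o_def)
  then have "\<beta> z \<ge> \<delta>"
    by (rule LIMSEQ_le_const) (use lower \<tau> in auto)
  moreover have "z \<in> closure \<Omega>"
    unfolding closure_sequential using lim g(1) c \<tau> by (intro exI[of _ "(\<lambda>n. g (c (\<tau> n))) \<circ> k"]) auto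
  ultimately have z: "z \<in> \<Omega>" using frontier[of z] \<open>\<delta> > 0\<close> by force
  have "(\<lambda>n. T (((\<lambda>n. g (c (\<tau> n))) \<circ> k) n)) \<longlonglongrightarrow> T z"
    by (rule continuous_on_tendsto_compose[OF contT lim z]) (use g(1) c \<tau> in auto)
  moreover have "T (((\<lambda>n. g (c (\<tau> n))) \<circ> k) n) = c (\<tau> (k n))" for n
    using g(2)[OF c] \<tau> by simp
  moreover have "(\<lambda>n. c (\<tau> (k n))) \<longlonglongrightarrow> c 1"
    unfolding c_def using LIMSEQ_subseq_LIMSEQ[OF \<tau>_lim k] by (intro tendsto_intros) (simp add: o_def)
  ultimately have "T z = c 1" using LIMSEQ_unique by simp
  then show False using w z by (auto simp: c_def v_def)
qed

section \<open>The entire Gauss map and Liouville's theorem\<close>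

lemma space_like_imp_constant:
  assumes "\<beta> z0 > 0"
  shows "p z = p z0 \<and> q z = q z0"
proof -
  obtain \<Omega> where \<Omega>: "open \<Omega>" "convex \<Omega>" "z0 \<in> \<Omega>" "\<And>z. z \<in> \<Omega> \<Longrightarrow> \<beta> z > 0"
    "\<And>z. z \<in> closure \<Omega> - \<Omega> \<Longrightarrow> \<beta> z = 0"
    using space_like_strip[OF assms] by blast
  obtain T where T: "\<And>z. z \<in> \<Omega> \<Longrightarrow> (T has_derivative flat z) (at z)"
    using flat_chart[OF \<Omega>(1,2,4)] by blast
  have surj: "T ` \<Omega> = UNIV"
    by (rule flat_chart_surj[OF \<Omega>(1,2) _ \<Omega>(4,5) T]) (use \<Omega>(3) in auto)
  have inj: "inj_on T \<Omega>"
    using flat_chart_expanding[OF \<Omega>(2,4) T] by (force simp: inj_on_def)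
  define g where "g = inv_into \<Omega> T"
  have gT: "g (T z) = z" if "z \<in> \<Omega>" for z using inj that by (simp add: g_def)
  \<comment> \<open>The conjugate of \<open>(p + i q) / (1 + b)\<close>; with this sign the
    composition with the inverse chart is holomorphic.\<close>
  define f where "f = (\<lambda>z. Complex (p z / (1 + b z)) (- q z / (1 + b z)))"
  have f_der: "\<exists>D. ((\<lambda>w. f (g w)) has_field_derivative D) (at (T z))" if z: "z \<in> \<Omega>" for z
  proof -
    have pos: "\<beta> z > 0" using \<Omega>(4)[OF z] .
    have b: "b z > 0" "b z \<noteq> 0" "1 + b z \<noteq> 0" using b_pos[OF pos] by auto
    have db: "((\<lambda>z. 1 + b z) has_derivative (\<lambda>h. b\<^sub>x z * Re h + b\<^sub>y z * Im h)) (at z)"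
      by (rule has_derivative_eq_rhs[OF has_derivative_add[OF has_derivative_const b_der[OF pos]]]) simp
    define u\<^sub>x where "u\<^sub>x = (r z * (1 + b z) - p z * b\<^sub>x z) / (1 + b z)\<^sup>2"
    define u\<^sub>y where "u\<^sub>y = (s z * (1 + b z) - p z * b\<^sub>y z) / (1 + b z)\<^sup>2"
    define v\<^sub>x where "v\<^sub>x = (s z * (1 + b z) - q z * b\<^sub>x z) / (1 + b z)\<^sup>2"
    define v\<^sub>y where "v\<^sub>y = (t z * (1 + b z) - q z * b\<^sub>y z) / (1 + b z)\<^sup>2"
    have du: "((\<lambda>z. p z / (1 + b z)) has_derivative (\<lambda>h. u\<^sub>x * Re h + u\<^sub>y * Im h)) (at z)"
      unfolding u\<^sub>x_def u\<^sub>y_def by (rule has_gradient_divide[OF p_der db b(3)])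
    have dv: "((\<lambda>z. q z / (1 + b z)) has_derivative (\<lambda>h. v\<^sub>x * Re h + v\<^sub>y * Im h)) (at z)"
      unfolding v\<^sub>x_def v\<^sub>y_def by (rule has_gradient_divide[OF q_der db b(3)])
    have f_eq: "f = (\<lambda>z. of_real (p z / (1 + b z)) - \<i> * of_real (q z / (1 + b z)))"
      by (simp add: f_def fun_eq_iff complex_eq_iff)
    have df: "(f has_derivative (\<lambda>h. of_real (u\<^sub>x * Re h + u\<^sub>y * Im h) - \<i> * of_real (v\<^sub>x * Re h + v\<^sub>y * Im h))) (at z)"
      unfolding f_eq
      by (intro has_derivative_diff has_derivative_mult_right has_derivative_of_real du dv)
    have dfg: "((\<lambda>w. f (g w)) has_derivative (\<lambda>h. of_real (u\<^sub>x * Re (unflat z h) + u\<^sub>y * Im (unflat z h))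
        - \<i> * of_real (v\<^sub>x * Re (unflat z h) + v\<^sub>y * Im (unflat z h)))) (at (T z))"
      using has_derivative_compose[OF flat_chart_inverse[OF \<Omega>(1,4) T gT z], of f] df gT[OF z] by simp
    \<comment> \<open>Up to a positive factor, the derivative of \<open>(p, q) / (1 + b)\<close> is
      the product \<open>N H\<close> of the matrix \<open>N\<close> with diagonal
      \<open>n\<^sub>1\<close>, \<open>n\<^sub>2\<close> and off-diagonal entry \<open>m\<close>,
      and the Hessian \<open>H\<close> of \<psi>.\<close>
    have u: "b z * (1 + b z)\<^sup>2 * u\<^sub>x = n\<^sub>1 z * r z + m z * s z" "b z * (1 + b z)\<^sup>2 * u\<^sub>y = n\<^sub>1 z * s z + m z * t z"
      "b z * (1 + b z)\<^sup>2 * v\<^sub>x = n\<^sub>2 z * s z + m z * r z" "b z * (1 + b z)\<^sup>2 * v\<^sub>y = n\<^sub>2 z * t z + m z * s z"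
    proof -
      have "(1 + b z)\<^sup>2 * u\<^sub>x = r z * (1 + b z) - p z * b\<^sub>x z" "(1 + b z)\<^sup>2 * u\<^sub>y = s z * (1 + b z) - p z * b\<^sub>y z"
        "(1 + b z)\<^sup>2 * v\<^sub>x = s z * (1 + b z) - q z * b\<^sub>x z" "(1 + b z)\<^sup>2 * v\<^sub>y = t z * (1 + b z) - q z * b\<^sub>y z"
        unfolding u\<^sub>x_def u\<^sub>y_def v\<^sub>x_def v\<^sub>y_def using b by auto
      then show "b z * (1 + b z)\<^sup>2 * u\<^sub>x = n\<^sub>1 z * r z + m z * s z" "b z * (1 + b z)\<^sup>2 * u\<^sub>y = n\<^sub>1 z * s z + m z * t z"
        "b z * (1 + b z)\<^sup>2 * v\<^sub>x = n\<^sub>2 z * s z + m z * r z" "b z * (1 + b z)\<^sup>2 * v\<^sub>y = n\<^sub>2 z * t z + m z * s z"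
        using b_times_gradient[OF pos] b_square[OF pos] unfolding n\<^sub>1_def n\<^sub>2_def m_def by algebra+
    qed
    \<comment> \<open>Composition with the inverse chart turns \<open>N H\<close> into
      \<open>N H N\<close>, up to a positive factor. Its trace is that of \<open>H N^2\<close>, and
      \<open>N^2\<close> is \<open>(1 + b)^2\<close> times the coefficient matrix of the zero mean
      curvature equation, so the trace vanishes.\<close>
    have cr1: "n\<^sub>1 z * u\<^sub>x + m z * u\<^sub>y = - (m z * v\<^sub>x + n\<^sub>2 z * v\<^sub>y)"
    proof -
      have n: "(n\<^sub>1 z)\<^sup>2 + (m z)\<^sup>2 = (1 + b z)\<^sup>2 * (1 - (q z)\<^sup>2)" "(n\<^sub>2 z)\<^sup>2 + (m z)\<^sup>2 = (1 + b z)\<^sup>2 * (1 - (p z)\<^sup>2)"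
        "n\<^sub>1 z + n\<^sub>2 z = (1 + b z)\<^sup>2"
        using b_square[OF pos] unfolding n\<^sub>1_def n\<^sub>2_def m_def by algebra+
      have "b z * (1 + b z)\<^sup>2 * (n\<^sub>1 z * u\<^sub>x + m z * u\<^sub>y + (m z * v\<^sub>x + n\<^sub>2 z * v\<^sub>y))
          = n\<^sub>1 z * (b z * (1 + b z)\<^sup>2 * u\<^sub>x) + m z * (b z * (1 + b z)\<^sup>2 * u\<^sub>y)
            + (m z * (b z * (1 + b z)\<^sup>2 * v\<^sub>x) + n\<^sub>2 z * (b z * (1 + b z)\<^sup>2 * v\<^sub>y))"
        by algebra
      also have "\<dots> = r z * ((n\<^sub>1 z)\<^sup>2 + (m z)\<^sup>2) + 2 * m z * s z * (n\<^sub>1 z + n\<^sub>2 z) + t z * ((n\<^sub>2 z)\<^sup>2 + (m z)\<^sup>2)"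
        unfolding u by algebra
      also have "\<dots> = (1 + b z)\<^sup>2 * ((1 - (q z)\<^sup>2) * r z + 2 * p z * q z * s z + (1 - (p z)\<^sup>2) * t z)"
        unfolding n unfolding m_def by algebra
      also have "\<dots> = 0" unfolding zmc by simp
      finally show ?thesis using b by (simp add: add_eq_0_iff)
    qed
    \<comment> \<open>The matrix \<open>N H N\<close> is symmetric; symmetry and zero trace together
      are the Cauchy-Riemann equations for the conjugate.\<close>
    have cr2: "m z * u\<^sub>x + n\<^sub>2 z * u\<^sub>y = n\<^sub>1 z * v\<^sub>x + m z * v\<^sub>y"
    proof -
      have "b z * (1 + b z)\<^sup>2 * (m z * u\<^sub>x + n\<^sub>2 z * u\<^sub>y) = b z * (1 + b z)\<^sup>2 * (n\<^sub>1 z * v\<^sub>x + m z * v\<^sub>y)"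
        using u by algebra
      then show ?thesis using b by simp
    qed
    define A where "A = (n\<^sub>1 z * u\<^sub>x + m z * u\<^sub>y) / (1 + b z)\<^sup>2"
    define A' where "A' = (m z * u\<^sub>x + n\<^sub>2 z * u\<^sub>y) / (1 + b z)\<^sup>2"
    have 1: "u\<^sub>x * Re (unflat z h) + u\<^sub>y * Im (unflat z h) = A * Re h + A' * Im h" for h
      unfolding unflat_def A_def A'_def by (simp flip: add_divide_distrib add: algebra_simps)
    have 2: "v\<^sub>x * Re (unflat z h) + v\<^sub>y * Im (unflat z h) = A' * Re h - A * Im h" for h
      unfolding unflat_def A_def A'_def cr1 cr2
      by (simp flip: add_divide_distrib diff_divide_distrib add: algebra_simps)
    have "((\<lambda>w. f (g w)) has_field_derivative Complex A (- A')) (at (T z))"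
      unfolding has_field_derivative_def
      by (rule has_derivative_eq_rhs[OF dfg[unfolded 1 2]])
        (auto simp: fun_eq_iff complex_eq_iff algebra_simps)
    then show ?thesis by blast
  qed
  have "(\<lambda>w. f (g w)) holomorphic_on UNIV"
    unfolding holomorphic_on_open[OF open_UNIV]
    using f_der surj by (metis UNIV_I imageE)
  moreover have "bounded (range (\<lambda>w. f (g w)))"
  proof (rule boundedI)
    fix y assume "y \<in> range (\<lambda>w. f (g w))"
    then obtain w where w: "y = f (g w)" by blast
    obtain z where z: "z \<in> \<Omega>" "w = T z" using surj by blast
    have pos: "\<beta> z > 0" using \<Omega>(4)[OF z(1)] .
    have "cmod (f z) \<le> \<bar>p z / (1 + b z)\<bar> + \<bar>q z / (1 + b z)\<bar>"
      unfolding f_def using cmod_le[of "Complex (p z / (1 + b z)) (- q z / (1 + b z))"] by simp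
    also have "\<dots> \<le> 1 + 1"
    proof -
      have "(p z)\<^sup>2 \<le> 1\<^sup>2" "(q z)\<^sup>2 \<le> 1\<^sup>2" using pos by (auto simp: \<beta>_def) (smt (verit) zero_le_power2)+
      then have "\<bar>p z\<bar> \<le> 1" "\<bar>q z\<bar> \<le> 1" by (auto simp: abs_square_le_1)
      then show ?thesis using b_pos[OF pos] by (intro add_mono) (auto simp: abs_divide divide_le_eq)
    qed
    finally show "norm y \<le> 2" using w z gT by simp
  qed
  ultimately obtain k where k: "\<And>w. f (g w) = k"
    using Liouville_theorem unfolding constant_on_def by blast
  have f_const: "f z = f z0" if "z \<in> \<Omega>" for z
    using k[of "T z"] k[of "T z0"] gT that \<Omega>(3) by simp
  have const: "p z = p z0 \<and> q z = q z0" if z: "z \<in> \<Omega>" for z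
  proof -
    \<comment> \<open>The modulus of \<open>f z\<close> determines \<open>b z\<close>, so constancy
      of \<open>f\<close> passes to \<open>b\<close> and then to \<open>p\<close> and
      \<open>q\<close>.\<close>
    have n: "(1 + b z) * (cmod (f z))\<^sup>2 = 1 - b z" "b z > 0" if "z \<in> \<Omega>" for z
    proof -
      have pos: "\<beta> z > 0" using \<Omega>(4)[OF that] .
      show b: "b z > 0" using b_pos[OF pos] .
      have "(1 + b z) * ((1 + b z) * (cmod (f z))\<^sup>2) = (p z)\<^sup>2 + (q z)\<^sup>2"
      proof -
        have "(cmod (f z))\<^sup>2 = ((p z)\<^sup>2 + (q z)\<^sup>2) / (1 + b z)\<^sup>2"
          unfolding f_def cmod_power2 by (simp add: power_divide add_divide_distrib)
        then show ?thesis using b by (simp add: power2_eq_square)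
      qed
      also have "\<dots> = (1 + b z) * (1 - b z)" using b_square[OF pos] by algebra
      finally show "(1 + b z) * (cmod (f z))\<^sup>2 = 1 - b z" using b by simp
    qed
    have "(1 + b z) * (1 - b z0) = (1 + b z0) * (1 - b z)"
      using n(1)[OF z] n(1)[OF \<Omega>(3)] unfolding f_const[OF z] by algebra
    then have b: "b z = b z0" by (simp add: algebra_simps)
    then show ?thesis using f_const[OF z] n(2)[OF z] by (simp add: f_def)
  qed
  \<comment> \<open>By continuity \<open>\<beta>\<close> keeps its positive value on the closure, so
    the frontier is empty and \<open>\<Omega>\<close> is open and closed.\<close>
  have "closure \<Omega> \<subseteq> \<Omega>"
  proof
    fix z assume z: "z \<in> closure \<Omega>"
    have "\<beta> z = \<beta> z0"
      using continuous_constant_on_closure[OF continuous_\<beta> _ z, of "\<beta> z0"] const by (simp add: \<beta>_def)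
    then show "z \<in> \<Omega>" using \<Omega>(5)[of z] z assms by force
  qed
  then have "closed \<Omega>" using closure_subset closure_eq by blast
  then have "\<Omega> = UNIV" using \<Omega>(1,3) clopen by blast
  then show ?thesis using const by blast
qed

end

section \<open>The function and its partial derivatives\<close>

lemma partial_x_DERIV:
  "has_partials f \<Longrightarrow> ((\<lambda>x. f (x, y)) has_real_derivative partial_x f (x, y)) (at x)"
  unfolding has_partials_def partial_x_def
  by (metis DERIV_deriv_iff_real_differentiable fst_conv snd_conv)

lemma partial_y_DERIV:
  "has_partials f \<Longrightarrow> ((\<lambda>y. f (x, y)) has_real_derivative partial_y f (x, y)) (at y)"
  unfolding has_partials_def partial_y_def
  by (metis DERIV_deriv_iff_real_differentiable fst_conv snd_conv)

lemma has_partials_has_derivative: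
  assumes f: "has_partials f" and cont: "continuous_on UNIV (partial_y f)"
  shows "((\<lambda>z. f (Re z, Im z)) has_derivative
    (\<lambda>h. partial_x f (Re z, Im z) * Re h + partial_y f (Re z, Im z) * Im h)) (at z)"
proof -
  define D where "D = (\<lambda>x y. partial_y f (x, y) *\<^sub>R (id_blinfun :: real \<Rightarrow>\<^sub>L real))"
  have "((\<lambda>(x, y). f (x, y)) has_derivative (\<lambda>(tx, ty). (\<lambda>h. partial_x f (Re z, Im z) * h) tx + blinfun_apply (D (Re z) (Im z)) ty))
    (at (Re z, Im z) within UNIV \<times> UNIV)"
  proof (rule has_derivative_partialsI[where f = "\<lambda>x y. f (x, y)"])
    show "((\<lambda>x. f (x, Im z)) has_derivative (\<lambda>h. partial_x f (Re z, Im z) * h)) (at (Re z) within UNIV)"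
      using partial_x_DERIV[OF f] by (simp add: has_field_derivative_def)
    show "((\<lambda>y. f (x, y)) has_derivative blinfun_apply (D x y)) (at y within UNIV)" for x y
    proof -
      have "blinfun_apply (D x y) = (*) (partial_y f (x, y))"
        by (simp add: D_def fun_eq_iff blinfun.bilinear_simps)
      then show ?thesis
        using partial_y_DERIV[OF f, of x y] by (simp add: has_field_derivative_def)
    qed
    have "continuous_on UNIV (\<lambda>(x, y). D x y)"
      unfolding D_def case_prod_beta prod.collapse by (intro continuous_intros cont)
    then show "continuous (at (Re z, Im z) within UNIV \<times> UNIV) (\<lambda>(x, y). D x y)"
      by (simp add: continuous_on_eq_continuous_within)
  qed auto
  then have d: "(f has_derivative (\<lambda>h. partial_x f (Re z, Im z) * fst h + partial_y f (Re z, Im z) * snd h)) (at (Re z, Im z))"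
    by (simp add: D_def blinfun.bilinear_simps case_prod_unfold)
  have "((\<lambda>z. (Re z, Im z)) has_derivative (\<lambda>h. (Re h, Im h))) (at z)"
    by (intro has_derivative_Pair bounded_linear_imp_has_derivative bounded_linear_Re bounded_linear_Im)
  from has_derivative_compose[OF this d] show ?thesis by simp
qed

lemma continuous_on_Re_Im:
  "continuous_on UNIV (f :: real \<times> real \<Rightarrow> real) \<Longrightarrow> continuous_on UNIV (\<lambda>z. f (Re z, Im z))"
  by (rule continuous_on_compose2[of UNIV f]) (auto intro!: continuous_intros)

lemma C_diff_0: "C_diff k f \<Longrightarrow> continuous_on UNIV f"
  by (cases k) auto

lemma C_diff_Suc_C1:
  assumes "C_diff (Suc k) f"
  shows "C1 (\<lambda>z. f (Re z, Im z))"
  using assms C_diff_0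
  by (intro C1_I[OF has_partials_has_derivative] continuous_on_Re_Im) auto

section \<open>Symmetry of the mixed partial derivatives\<close>

text \<open>The mean value theorem in \<open>x\<close> for \<open>f x (c + h) - f x c\<close>, then
  in \<open>y\<close> for \<open>fx\<close>.\<close>

lemma mixed_difference:
  fixes f :: "real \<Rightarrow> real \<Rightarrow> real"
  assumes fx: "\<And>x y. ((\<lambda>x. f x y) has_real_derivative fx x y) (at x)"
    and fxy: "\<And>x y. ((\<lambda>y. fx x y) has_real_derivative fxy x y) (at y)" and "h > 0"
  obtains \<xi> \<eta> where "\<xi> \<in> {a<..<a + h}" "\<eta> \<in> {c<..<c + h}"
    "f (a + h) (c + h) - f (a + h) c - f a (c + h) + f a c = h * h * fxy \<xi> \<eta>"
proof -
  obtain \<xi> where \<xi>: "a < \<xi>" "\<xi> < a + h"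
    "(f (a + h) (c + h) - f (a + h) c) - (f a (c + h) - f a c) = (a + h - a) * (fx \<xi> (c + h) - fx \<xi> c)"
    using MVT2[of a "a + h" "\<lambda>x. f x (c + h) - f x c" "\<lambda>x. fx x (c + h) - fx x c"] \<open>h > 0\<close>
      DERIV_diff[OF fx fx] by auto
  obtain \<eta> where \<eta>: "c < \<eta>" "\<eta> < c + h" "fx \<xi> (c + h) - fx \<xi> c = (c + h - c) * fxy \<xi> \<eta>"
    using MVT2[of c "c + h" "fx \<xi>" "fxy \<xi>"] \<open>h > 0\<close> fxy by auto
  show ?thesis
    by (rule that[of \<xi> \<eta>]) (use \<xi> \<eta> in \<open>auto simp: algebra_simps\<close>)
qed

text \<open>The second difference over a square is symmetric in the two variables, so the two mixed
  derivatives agree at some pair of points of the square; continuity concludes as the square shrinks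
  to \<open>(a, c)\<close>.\<close>

lemma mixed_partials_commute:
  assumes f: "has_partials f" and fx: "has_partials (partial_x f)" and fy: "has_partials (partial_y f)"
    and cont: "continuous_on UNIV (partial_y (partial_x f))" "continuous_on UNIV (partial_x (partial_y f))"
  shows "partial_y (partial_x f) (a, c) = partial_x (partial_y f) (a, c)"
proof -
  have "\<exists>\<xi> \<eta> \<xi>' \<eta>'. \<xi> \<in> {a<..<a + h} \<and> \<eta> \<in> {c<..<c + h} \<and> \<xi>' \<in> {a<..<a + h} \<and> \<eta>' \<in> {c<..<c + h} \<and>
    partial_y (partial_x f) (\<xi>, \<eta>) = partial_x (partial_y f) (\<xi>', \<eta>')" if h: "h > 0" for h
  proof -
    obtain \<xi> \<eta> where 1: "\<xi> \<in> {a<..<a + h}" "\<eta> \<in> {c<..<c + h}"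
      "f (a + h, c + h) - f (a + h, c) - f (a, c + h) + f (a, c) = h * h * partial_y (partial_x f) (\<xi>, \<eta>)"
      using mixed_difference[of "\<lambda>x y. f (x, y)" "\<lambda>x y. partial_x f (x, y)" "\<lambda>x y. partial_y (partial_x f) (x, y)",
          OF partial_x_DERIV[OF f] partial_y_DERIV[OF fx] h] by blast
    obtain \<eta>' \<xi>' where 2: "\<eta>' \<in> {c<..<c + h}" "\<xi>' \<in> {a<..<a + h}"
      "f (a + h, c + h) - f (a, c + h) - f (a + h, c) + f (a, c) = h * h * partial_x (partial_y f) (\<xi>', \<eta>')"
      using mixed_difference[of "\<lambda>y x. f (x, y)" "\<lambda>y x. partial_y f (x, y)" "\<lambda>y x. partial_x (partial_y f) (x, y)",
          OF partial_y_DERIV[OF f] partial_x_DERIV[OF fy] h] by blast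
    have "h * h * partial_y (partial_x f) (\<xi>, \<eta>) = h * h * partial_x (partial_y f) (\<xi>', \<eta>')"
      using 1(3) 2(3) by linarith
    then show ?thesis using 1 2 h by auto
  qed
  then have "\<forall>n. \<exists>\<xi> \<eta> \<xi>' \<eta>'. \<xi> \<in> {a<..<a + inverse (real (Suc n))} \<and> \<eta> \<in> {c<..<c + inverse (real (Suc n))} \<and>
    \<xi>' \<in> {a<..<a + inverse (real (Suc n))} \<and> \<eta>' \<in> {c<..<c + inverse (real (Suc n))} \<and>
    partial_y (partial_x f) (\<xi>, \<eta>) = partial_x (partial_y f) (\<xi>', \<eta>')" by simp
  then obtain \<xi> \<eta> \<xi>' \<eta>' where *: "\<And>n. \<xi> n \<in> {a<..<a + inverse (real (Suc n))}"
    "\<And>n. \<eta> n \<in> {c<..<c + inverse (real (Suc n))}" "\<And>n. \<xi>' n \<in> {a<..<a + inverse (real (Suc n))}"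
    "\<And>n. \<eta>' n \<in> {c<..<c + inverse (real (Suc n))}"
    "\<And>n. partial_y (partial_x f) (\<xi> n, \<eta> n) = partial_x (partial_y f) (\<xi>' n, \<eta>' n)"
    by metis
  have sq: "g \<longlonglongrightarrow> d" if "\<And>n. g n \<in> {d<..<d + inverse (real (Suc n))}" for g :: "nat \<Rightarrow> real" and d
  proof (rule tendsto_sandwich[of "\<lambda>_. d" g _ "\<lambda>n. d + inverse (real (Suc n))"])
    show "(\<lambda>n. d + inverse (real (Suc n))) \<longlonglongrightarrow> d" by (rule LIMSEQ_inverse_real_of_nat_add)
  qed (use that in \<open>auto simp: less_imp_le\<close>)
  have "(\<lambda>n. partial_y (partial_x f) (\<xi> n, \<eta> n)) \<longlonglongrightarrow> partial_y (partial_x f) (a, c)"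
    by (rule continuous_on_tendsto_compose[OF cont(1) tendsto_Pair[OF sq sq]]) (use * in auto)
  moreover have "(\<lambda>n. partial_x (partial_y f) (\<xi>' n, \<eta>' n)) \<longlonglongrightarrow> partial_x (partial_y f) (a, c)"
    by (rule continuous_on_tendsto_compose[OF cont(2) tendsto_Pair[OF sq sq]]) (use * in auto)
  ultimately show ?thesis using LIMSEQ_unique *(5) by simp
qed

section \<open>From a constant gradient to a planar graph\<close>

theorem theoremA:
  fixes \<psi> :: "real \<times> real \<Rightarrow> real"
  assumes "C_diff 3 \<psi>"
    and "\<And>p. zmc_equation \<psi> p"
    and "\<not> is_plane (graph_of \<psi>)"
    and "\<exists>p. space_like \<psi> p"
  shows "\<exists>p. nondegenerate_light_like \<psi> p"
proof (rule ccontr)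
  assume no: "\<nexists>p. nondegenerate_light_like \<psi> p"
  have C: "C_diff 2 (partial_x \<psi>)" "C_diff 2 (partial_y \<psi>)" "has_partials \<psi>"
    using assms(1) by (auto simp: numeral_3_eq_3 numeral_2_eq_2)
  then have C': "C_diff 1 (partial_x (partial_x \<psi>))" "C_diff 1 (partial_y (partial_x \<psi>))"
    "C_diff 1 (partial_y (partial_y \<psi>))" "C_diff 1 (partial_x (partial_y \<psi>))"
    "has_partials (partial_x \<psi>)" "has_partials (partial_y \<psi>)"
    by (auto simp: numeral_2_eq_2)
  note cont = C(1,2)[THEN C_diff_0] C'(1-4)[THEN C_diff_0]
  have sym: "partial_x (partial_y \<psi>) P = partial_y (partial_x \<psi>) P" for P
    using mixed_partials_commute[OF C(3) C'(5,6) cont(4,6)] by (cases P) simp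
  define p where "p = (\<lambda>z. partial_x \<psi> (Re z, Im z))"
  define q where "q = (\<lambda>z. partial_y \<psi> (Re z, Im z))"
  define r where "r = (\<lambda>z. partial_x (partial_x \<psi>) (Re z, Im z))"
  define s where "s = (\<lambda>z. partial_y (partial_x \<psi>) (Re z, Im z))"
  define t where "t = (\<lambda>z. partial_y (partial_y \<psi>) (Re z, Im z))"
  have B_x: "partial_x (B \<psi>) (x, y) = - 2 * (partial_x \<psi> (x, y) * partial_x (partial_x \<psi>) (x, y)
      + partial_y \<psi> (x, y) * partial_y (partial_x \<psi>) (x, y))" for x y
  proof -
    have "((\<lambda>x. B \<psi> (x, y)) has_real_derivative - 2 * (partial_x \<psi> (x, y) * partial_x (partial_x \<psi>) (x, y)
      + partial_y \<psi> (x, y) * partial_y (partial_x \<psi>) (x, y))) (at x)"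
      unfolding B_def
      by (rule derivative_eq_intros partial_x_DERIV[OF C'(5)] partial_x_DERIV[OF C'(6)] refl)+
        (simp add: sym algebra_simps)
    then show ?thesis unfolding partial_x_def[of "B \<psi>"] by (simp add: DERIV_imp_deriv)
  qed
  have B_y: "partial_y (B \<psi>) (x, y) = - 2 * (partial_x \<psi> (x, y) * partial_y (partial_x \<psi>) (x, y)
      + partial_y \<psi> (x, y) * partial_y (partial_y \<psi>) (x, y))" for x y
  proof -
    have "((\<lambda>y. B \<psi> (x, y)) has_real_derivative - 2 * (partial_x \<psi> (x, y) * partial_y (partial_x \<psi>) (x, y)
      + partial_y \<psi> (x, y) * partial_y (partial_y \<psi>) (x, y))) (at y)"
      unfolding B_def
      by (rule derivative_eq_intros partial_y_DERIV[OF C'(5)] partial_y_DERIV[OF C'(6)] refl)+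
        (simp add: algebra_simps)
    then show ?thesis unfolding partial_y_def[of "B \<psi>"] by (simp add: DERIV_imp_deriv)
  qed
  \<comment> \<open>The denial \<open>no\<close> supplies the assumption that light-like points are
    degenerate, and \<open>sym\<close> lets \<open>s\<close> serve as both mixed
    derivatives.\<close>
  interpret zmc_gradient p q r s t
  proof
    fix z
    show "(p has_derivative (\<lambda>h. r z * Re h + s z * Im h)) (at z)"
      unfolding p_def r_def s_def by (rule has_partials_has_derivative[OF C'(5) cont(4)])
    show "(q has_derivative (\<lambda>h. s z * Re h + t z * Im h)) (at z)"
      unfolding q_def s_def t_def sym[symmetric] by (rule has_partials_has_derivative[OF C'(6) cont(5)])
    show "C1 r" "C1 s" "C1 t"
      unfolding r_def s_def t_def using C'(1-3)[unfolded One_nat_def, THEN C_diff_Suc_C1] .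
    show "(1 - (q z)\<^sup>2) * r z + 2 * p z * q z * s z + (1 - (p z)\<^sup>2) * t z = 0"
      using assms(2)[of "(Re z, Im z)"] by (simp add: zmc_equation_def p_def q_def r_def s_def t_def)
    assume "(p z)\<^sup>2 + (q z)\<^sup>2 = 1"
    then have "light_like \<psi> (Re z, Im z)"
      by (simp add: light_like_def B_def p_def q_def)
    then have "grad (B \<psi>) (Re z, Im z) = (0, 0)"
      using no by (auto simp: nondegenerate_light_like_def)
    then show "p z * r z + q z * s z = 0 \<and> p z * s z + q z * t z = 0"
      by (simp add: grad_def B_x B_y p_def q_def r_def s_def t_def)
  qed
  obtain x0 y0 where "space_like \<psi> (x0, y0)" using assms(4) by auto
  then have "\<beta> (Complex x0 y0) > 0"
    unfolding \<beta>_def space_like_def B_def by (simp add: p_def q_def)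
  from space_like_imp_constant[OF this] obtain k l where kl: "\<And>z. p z = k" "\<And>z. q z = l" by blast
  define F where "F = (\<lambda>z. \<psi> (Re z, Im z) - (k * Re z + l * Im z))"
  have "(F has_derivative (\<lambda>h. 0)) (at z)" for z
  proof -
    have "((\<lambda>z. \<psi> (Re z, Im z)) has_derivative (\<lambda>h. k * Re h + l * Im h)) (at z)"
      using has_partials_has_derivative[OF C(3) cont(2), of z] kl[of z] by (simp add: p_def q_def)
    then show ?thesis
      unfolding F_def by (auto intro!: derivative_eq_intros)
  qed
  then obtain d where "\<And>z. F z = d"
    using has_derivative_zero_constant[of UNIV F] by auto
  from this[of "Complex x y" for x y] have "\<psi> (x, y) = d + (k * x + l * y)" for x y
    by (simp add: F_def algebra_simps)
  then have "linear (\<lambda>P. \<psi> P - \<psi> (0, 0))"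
    by (intro linearI) (auto simp: algebra_simps)
  then show False using assms(3) is_plane_graph_iff by blast
qed

end
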